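(* Let $n\geq 2$ be an integer. Let $\lambda$ be a compactly supported Borel probability measure on $\mathbb{R}^n$. (1) Suppose that $\dim_{l^1}\lambda>n-1$. Then for each $x\in\mathbb{R}^n\setminus\mathrm{supp}(\lambda)$, if $\dim_{\mathrm{H}}\Pi_x(\lambda)=n-1$, then $\Pi_x(\lambda)$ is absolutely continuous with respect to Lebesgue measure on $S^{n-1}$. (2) Suppose that for an integer $p>1$, $\dim_{l^1}\lambda>n-p^{-1}$. Then for each $x\in\mathbb{R}^n\setminus\mathrm{supp}(\lambda)$, $\Pi_x(\lambda)$ is absolutely continuous with respect to Lebesgue measure on $S^{n-1}$ with a density function in $L^{p}(S^{n-1})$. (Here the condition $\dim_{\mathrm{H}}\Pi_x(\lambda)=n-1$ is not required.)
   Context: Fourier transform: for a compactly supported Borel probability measure $\lambda$ on $\mathbb{R}^n$, $\hat\lambda(\xi)=\int_{\mathbb{R}^n}e^{-2\pi i(x,\xi)}\,d\lambda(x)$, where $(\cdot,\cdot)$ is the standard Euclidean inner product. $l^1$-dimension: $$\dim_{l^1}\lambda=\sup\Big\{s>0:\ \sup_{\theta\in[0,1]^n}\sum_{\xi\in\mathbb{Z}^n,\,|\xi|\le R}|\hat\lambda(\xi+\theta)|\ll R^{n-s}\Big\},$$ where $\ll$ means that the left side is at most a constant (independent of $R$) times the right side, for all $R\ge 1$. Radial projection: for $x\in\mathbb{R}^n$ let $\Pi_x:\mathbb{R}^n\setminus\{x\}\to S^{n-1}$, $\Pi_x(y)=\frac{y-x}{|y-x|}$. For $x\notin\mathrm{supp}(\lambda)$,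 $\Pi_x(\lambda)$ denotes the push-forward of $\lambda$ under $\Pi_x$, a Borel probability measure on the unit sphere $S^{n-1}$. Hausdorff dimension of a measure: for a Borel probability measure $\mu$, $\dim_{\mathrm{H}}\mu$ means the lower Hausdorff dimension $\inf\{\dim_{\mathrm{H}}A:\ A\text{ Borel},\ \mu(A)>0\}$. *)

theory Defs
  imports "HOL-Probability.Probability"
begin

definition measure_support :: "'a::topological_space measure \<Rightarrow> 'a set" where
  "measure_support M = {x. \<forall>U. open U \<longrightarrow> x \<in> U \<longrightarrow> emeasure M U > 0}"

definition fourier_transform :: "(real^'n) measure \<Rightarrow> real^'n \<Rightarrow> complex" where
  "fourier_transform M \<xi> =
     (LINT x|M. exp (- 2 * complex_of_real pi * \<i> * complex_of_real (x \<bullet> \<xi>)))"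

definition lattice_ball :: "real \<Rightarrow> (real^'n) set" where
  "lattice_ball R = {\<xi>. (\<forall>i. \<xi> $ i \<in> \<int>) \<and> norm \<xi> \<le> R}"

text \<open>The dimension takes values in the extended nonnegative reals, so that the supremum is \<open>0\<close>
  if no \<open>s > 0\<close> is admissible. The box below is the unit cube, since \<open>1\<close> is the all-ones vector.
  The sum is over a finite set and the real supremum is over a bounded set for finite measures;
  see \<open>finite_lattice_ball\<close> and \<open>bdd_above_fourier_sums\<close>.\<close>

definition l1_dim :: "(real^'n) measure \<Rightarrow> ennreal" where
  "l1_dim M = Sup (ennreal ` {s. s > 0 \<and>
     (\<exists>C. \<forall>R\<ge>1. (SUP \<theta>\<in>cbox 0 1. \<Sum>\<xi>\<in>lattice_ball R. cmod (fourier_transform M (\<xi> + \<theta>)))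
                  \<le> C * R powr (real CARD('n) - s))})"

text \<open>Boundedness is required separately because \<^const>\<open>diameter\<close> is meaningless on unbounded
  sets. We only use exponents \<open>s > 0\<close>, for which \<open>0 powr s = 0\<close> is the right value for
  covering sets that are empty or singletons.\<close>

definition hausdorff_premeasure :: "real \<Rightarrow> real \<Rightarrow> 'a::metric_space set \<Rightarrow> ennreal" where
  "hausdorff_premeasure s \<delta> A =
     (INF U\<in>{U :: nat \<Rightarrow> 'a set. A \<subseteq> (\<Union>i. U i) \<and> (\<forall>i. bounded (U i) \<and> diameter (U i) \<le> \<delta>)}.
        \<Sum>i. ennreal (diameter (U i) powr s))"

definition hausdorff_measure :: "real \<Rightarrow> 'a::metric_space set \<Rightarrow> ennreal" where
  "hausdorff_measure s A = (SUP \<delta>\<in>{0<..}. hausdorff_premeasure s \<delta> A)"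

definition hausdorff_dim :: "'a::metric_space set \<Rightarrow> ennreal" where
  "hausdorff_dim A = Inf (ennreal ` {s. s > 0 \<and> hausdorff_measure s A = 0})"

definition lower_hausdorff_dim :: "'a::metric_space measure \<Rightarrow> ennreal" where
  "lower_hausdorff_dim M = (INF A\<in>{A \<in> sets M. emeasure M A > 0}. hausdorff_dim A)"

definition radial_proj :: "'a::real_normed_vector \<Rightarrow> 'a \<Rightarrow> 'a" where
  "radial_proj x y = (y - x) /\<^sub>R norm (y - x)"

abbreviation sphere_borel :: "'a::euclidean_space measure" where
  "sphere_borel \<equiv> restrict_space borel (sphere 0 1)"

text \<open>The map is only defined off \<open>x\<close>, hence the restriction. No mass is lost when \<open>x\<close> is not in
  the support; see \<open>prob_space_radial_pushforward\<close>.\<close>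

definition radial_pushforward :: "'a::euclidean_space \<Rightarrow> 'a measure \<Rightarrow> 'a measure" where
  "radial_pushforward x M = distr (restrict_space M (- {x})) sphere_borel (radial_proj x)"

text \<open>Lebesgue (surface) measure on the unit sphere, as given by polar coordinates: the measure of
  a Borel set \<open>A\<close> is the dimension times the Lebesgue measure of the truncated cone
  \<open>{r *\<^sub>R u | r u. 0 < r \<and> r < 1 \<and> u \<in> A}\<close>.\<close>

definition sphere_measure :: "'a::euclidean_space measure" where
  "sphere_measure = scale_measure (of_nat DIM('a))
     (distr (restrict_space lborel (ball 0 1 - {0})) sphere_borel (radial_proj 0))"

lemma finite_lattice_ball: "finite (lattice_ball R :: (real^'n) set)"
proof -
  let ?S = "real_of_int ` {k::int. \<bar>real_of_int k\<bar> \<le> R}"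
  have "{k::int. \<bar>real_of_int k\<bar> \<le> R} \<subseteq> {- \<lceil>R\<rceil>..\<lceil>R\<rceil>}"
    by (auto simp: abs_le_iff) linarith+
  then have "finite ?S"
    by (meson finite_atLeastAtMost_int finite_imageI finite_subset)
  then have fin: "finite (vec_lambda ` (UNIV \<rightarrow>\<^sub>E ?S) :: (real^'n) set)"
    by (rule finite_imageI[OF finite_PiE[OF finite_class.finite_UNIV]])
  have "\<xi> $ i \<in> ?S" if "\<xi> \<in> lattice_ball R" for \<xi> :: "real^'n" and i
    using that by (auto simp: lattice_ball_def Ints_def image_iff)
      (metis component_le_norm_cart order_trans rangeE)
  then have "lattice_ball R \<subseteq> (vec_lambda ` (UNIV \<rightarrow>\<^sub>E ?S) :: (real^'n) set)"
    by (intro subsetI image_eqI[where x = "vec_nth _"]) auto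
  then show ?thesis
    using fin by (rule finite_subset)
qed

lemma cmod_fourier_transform_le:
  assumes "prob_space M"
  shows "cmod (fourier_transform M \<xi>) \<le> 1"
proof -
  interpret prob_space M by fact
  have "cmod (fourier_transform M \<xi>) \<le>
      (LINT x|M. cmod (exp (- 2 * complex_of_real pi * \<i> * complex_of_real (x \<bullet> \<xi>))))"
    unfolding fourier_transform_def by (rule integral_norm_bound)
  also have "\<dots> = (LINT x|M. 1)"
    by (simp add: norm_exp_eq_Re)
  finally show ?thesis by (simp add: prob_space)
qed

lemma bdd_above_fourier_sums:
  assumes "prob_space M"
  shows "bdd_above ((\<lambda>\<theta>. \<Sum>\<xi>\<in>lattice_ball R. cmod (fourier_transform M (\<xi> + \<theta>))) ` B)"
  by (rule bdd_aboveI2[where M = "\<Sum>\<xi>\<in>lattice_ball R. 1"], rule sum_mono)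
    (rule cmod_fourier_transform_le[OF assms])

lemma measurable_radial_proj:
  fixes x :: "'a::euclidean_space"
  assumes "sets M = sets borel"
  shows "radial_proj x \<in> restrict_space M (- {x}) \<rightarrow>\<^sub>M sphere_borel"
proof (rule measurable_restrict_space2)
  have sp: "space M = UNIV" using sets_eq_imp_space_eq[OF assms] by simp
  show "radial_proj x \<in> space (restrict_space M (- {x})) \<rightarrow> sphere 0 1"
    by (auto simp: radial_proj_def space_restrict_space sp)
  have "radial_proj x \<in> borel \<rightarrow>\<^sub>M borel"
    unfolding radial_proj_def by measurable
  then have "radial_proj x \<in> M \<rightarrow>\<^sub>M borel"
    using measurable_cong_sets[OF assms refl] by blast
  then show "radial_proj x \<in> restrict_space M (- {x}) \<rightarrow>\<^sub>M borel"
    by (rule measurable_restrict_space1)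
qed

lemma prob_space_radial_pushforward:
  fixes x :: "'a::euclidean_space"
  assumes M: "prob_space M" "sets M = sets borel" and x: "x \<notin> measure_support M"
  shows "prob_space (radial_pushforward x M)"
proof -
  interpret prob_space M by fact
  obtain U where "open U" "x \<in> U" "emeasure M U = 0"
    using x by (auto simp: measure_support_def not_gr_zero)
  then have "emeasure M {x} = 0"
    by (metis M(2) borel_open emeasure_mono empty_subsetI insert_subset le_zero_eq)
  moreover have sp: "space M = UNIV" using sets_eq_imp_space_eq[OF M(2)] by simp
  ultimately have "emeasure M (- {x}) = 1"
    using M(2) emeasure_Diff[of M "{x}" UNIV] emeasure_space_1 by (simp add: Compl_eq_Diff_UNIV)
  then have "prob_space (restrict_space M (- {x}))"
    using M(2) by (intro prob_space_restrict_space) auto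
  then show ?thesis
    unfolding radial_pushforward_def
    by (rule prob_space.prob_space_distr) (rule measurable_radial_proj[OF M(2)])
qed

end

theory Submission
  imports Defs
begin

text \<open>
  Translate so that the centre of projection is the origin, and write \<open>\<Pi> y = y / |y|\<close> and \<open>B\<close> for the
  unit ball. For a measure \<open>\<lambda>\<close> with a nice density, the density of its radial projection at a
  direction \<open>u\<close> is an integral of that density over the ray through \<open>u\<close>. By Fourier inversion, an
  integral over a ray is an integral of \<open>\<lambda>^\<close> against a weight that depends on \<open>u \<bullet> \<xi>\<close> only and
  decays in it, so it is governed by the values of \<open>\<lambda>^\<close> near the hyperplane orthogonal to \<open>u\<close>. With
  a Gaussian weight along the ray this gives the majorant
    \<open>F z = \<integral> |\<lambda>^ \<xi>| exp (- 2 \<pi>\<^sup>2 (z \<bullet> \<xi>)\<^sup>2) d\<xi>\<close>,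
  called the slab integral below. The argument has three parts.

  Domination. If \<open>\<lambda>\<close> has bounded support and no mass at the origin, then
  \<open>\<integral> h d(\<Pi>\<lambda>) \<le> K \<integral>\<^sub>B h (\<Pi> z) F z dz\<close> for all Borel \<open>h \<ge> 0\<close> (lemma
  \<open>nn_integral_radial_proj_le\<close>). The variable \<open>z\<close> ranges over the whole ball and not
  over the sphere, in accordance with the definition of surface measure by cones. One first mollifies \<open>\<lambda>\<close> by a Gaussian, compares cones with averages over
  rays, and lets the mollification parameter tend to \<open>0\<close>. By Fatou's lemma this gives the
  inequality for open sets of directions; outer regularity extends it to Borel sets.

  Integrability. As \<open>z\<close> runs through \<open>B\<close>, the slab weight of frequency \<open>\<xi>\<close> has mass at most
  \<open>c / max 1 |\<xi>|\<close> (lemma \<open>ball_slab_mass_le\<close>). So the \<open>L\<^sup>p\<close> norm of the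
  weight is at most a constant times \<open>(max 1 |\<xi>|) powr (- 1/p)\<close>, and by Minkowski's inequality \<open>F\<close>
  is in \<open>L\<^sup>p(B)\<close> as soon as \<open>\<integral> |\<lambda>^ \<xi>| (max 1 |\<xi>|) powr (- 1/p) d\<xi>\<close> is finite. A dyadic
  decomposition deduces this finiteness from \<open>dim \<lambda> > n - 1/p\<close>: the supremum over shifts of the
  lattice bounds the integral over balls (lemma \<open>fourier_weighted_integral_finite\<close>).

  Conclusion. Domination by \<open>F dz\<close> with \<open>F\<close> integrable gives absolute continuity. For the \<open>L\<^sup>p\<close>
  bound, let \<open>g\<close> be the density and \<open>u = min g k\<close>. Then \<open>\<integral> u\<^sup>p \<le> \<integral> u\<^sup>p\<^sup>-\<^sup>1 g\<close>, the right side is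
  dominated by \<open>K \<integral>\<^sub>B u\<^sup>p\<^sup>-\<^sup>1 F\<close>, and Young's inequality, applied for each frequency with a parameter
  proportional to \<open>(max 1 |\<xi>|) powr (- 1/p)\<close>, bounds this by half of \<open>\<integral> u\<^sup>p\<close> plus a constant
  independent of \<open>k\<close>. This plays the role of Minkowski's inequality and of duality at once.
  Both parts of the theorem use the same argument, the first with \<open>p = 1\<close>.
\<close>

section \<open>Fourier transforms of Gaussians\<close>

lemma has_bochner_integral_gaussian_fourier_real:
  "has_bochner_integral lborel
     (\<lambda>t. complex_of_real (exp (- t\<^sup>2 / 2)) * exp (\<i> * complex_of_real (t * s)))
     (complex_of_real (sqrt (2 * pi) * exp (- s\<^sup>2 / 2)))"
proof (rule has_bochner_integral_iff[THEN iffD2], intro conjI)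
  have 1: "complex_of_real (exp (- t\<^sup>2 / 2)) * exp (\<i> * complex_of_real (t * s)) =
      complex_of_real (sqrt (2 * pi)) * (std_normal_density t *\<^sub>R exp (\<i> * complex_of_real (s * t)))" for t
    by (simp add: std_normal_density_def scaleR_conv_of_real mult_ac)
  have i: "integrable lborel (\<lambda>t. std_normal_density t *\<^sub>R exp (\<i> * complex_of_real (s * t)))"
    by (rule Bochner_Integration.integrable_bound[OF integrable_normal_density[of 1 0]])
      (auto simp: normal_density_nonneg)
  show "integrable lborel
     (\<lambda>t. complex_of_real (exp (- t\<^sup>2 / 2)) * exp (\<i> * complex_of_real (t * s)))"
    unfolding 1 by (intro integrable_mult_right i)
  have "char std_normal_distribution s = complex_of_real (exp (- (s^2) / 2))"
    by (simp add: char_std_normal_distribution)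
  then have "(LINT t|lborel. std_normal_density t *\<^sub>R exp (\<i> * complex_of_real (s * t)))
        = complex_of_real (exp (- s\<^sup>2 / 2))"
    unfolding char_def by (subst (asm) integral_density) (auto simp: normal_density_nonneg)
  then show "(LINT t|lborel. complex_of_real (exp (- t\<^sup>2 / 2)) * exp (\<i> * complex_of_real (t * s)))
     = complex_of_real (sqrt (2 * pi) * exp (- s\<^sup>2 / 2))"
    unfolding 1 integral_mult_right_zero by simp
qed

text \<open>
  Both the Gaussian and the character split into products over an orthonormal basis, and Lebesgue
  measure is the image of a product measure, so the one-dimensional formula can be multiplied up.
\<close>

lemma has_bochner_integral_gaussian_fourier:
  fixes y :: "'a::euclidean_space"
  shows "has_bochner_integral lborel
     (\<lambda>x. complex_of_real (exp (- (norm x)\<^sup>2 / 2)) * exp (\<i> * complex_of_real (x \<bullet> y)))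
     (complex_of_real (sqrt (2 * pi) ^ DIM('a) * exp (- (norm y)\<^sup>2 / 2)))"
proof -
  interpret product_sigma_finite "\<lambda>b::'a. lborel :: real measure" ..
  let ?h = "\<lambda>b t. complex_of_real (exp (- t\<^sup>2 / 2)) * exp (\<i> * complex_of_real (t * (y \<bullet> b)))"
  let ?f = "\<lambda>x::'a. complex_of_real (exp (- (norm x)\<^sup>2 / 2)) * exp (\<i> * complex_of_real (x \<bullet> y))"
  let ?T = "\<lambda>f. \<Sum>b\<in>Basis. f b *\<^sub>R (b::'a)"
  have e: "exp (- (\<Sum>b\<in>Basis. (v b)\<^sup>2) / 2)
        = (\<Prod>b\<in>Basis. exp (- (v b)\<^sup>2 / 2))" for v :: "'a \<Rightarrow> real"
    by (simp add: exp_sum[symmetric] sum_negf sum_divide_distrib)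
  have nrm: "(norm x)\<^sup>2 = (\<Sum>b\<in>Basis. (x \<bullet> b)\<^sup>2)" for x :: 'a
    by (subst power2_norm_eq_inner, subst euclidean_inner) (simp add: power2_eq_square)
  have prod: "?f (?T f) = (\<Prod>b\<in>Basis. ?h b (f b))" for f
  proof -
    have "(norm (?T f))\<^sup>2 = (\<Sum>b\<in>Basis. (f b)\<^sup>2)"
      unfolding nrm by (intro sum.cong) (auto simp: inner_sum_left inner_Basis if_distrib cong: if_cong)
    moreover have "?T f \<bullet> y = (\<Sum>b\<in>Basis. f b * (y \<bullet> b))"
      by (subst inner_sum_left, rule sum.cong) (simp_all add: inner_commute)
    moreover have "exp (\<i> * complex_of_real (\<Sum>b\<in>Basis. f b * (y \<bullet> b))) =
        (\<Prod>b\<in>Basis. exp (\<i> * complex_of_real (f b * (y \<bullet> b))))"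
      by (simp only: of_real_sum sum_distrib_left exp_sum finite_Basis)
    ultimately show ?thesis
      by (simp only: e prod.distrib of_real_prod)
  qed
  have meas: "?T \<in> (\<Pi>\<^sub>M b\<in>Basis. lborel) \<rightarrow>\<^sub>M borel" by measurable
  have i: "\<And>b. b \<in> Basis \<Longrightarrow> integrable lborel (?h b)"
    and v: "\<And>b. b \<in> Basis \<Longrightarrow> integral\<^sup>L lborel (?h b)
          = complex_of_real (sqrt (2 * pi) * exp (- (y \<bullet> b)\<^sup>2 / 2))"
    using has_bochner_integral_gaussian_fourier_real by (auto simp: has_bochner_integral_iff)
  have "integrable (\<Pi>\<^sub>M b\<in>Basis. lborel) (\<lambda>f. ?f (?T f))"
    unfolding prod by (rule product_integrable_prod[OF finite_Basis i])
  then have 1: "integrable lborel ?f"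
    by (subst lborel_eq, subst integrable_distr_eq[OF meas]) auto
  have "integral\<^sup>L lborel ?f = (LINT f|(\<Pi>\<^sub>M b\<in>Basis. lborel). ?f (?T f))"
    by (subst lborel_eq, subst integral_distr[OF meas]) auto
  also have "\<dots> = (\<Prod>b\<in>Basis. complex_of_real (sqrt (2 * pi) * exp (- (y \<bullet> b)\<^sup>2 / 2)))"
    unfolding prod
    by (subst product_integral_prod[OF finite_Basis i], assumption, rule prod.cong[OF refl v])
  also have "\<dots> = complex_of_real (sqrt (2 * pi) ^ DIM('a) * exp (- (norm y)\<^sup>2 / 2))"
    by (simp only: nrm e of_real_prod[symmetric] prod.distrib prod_constant)
  finally show ?thesis using 1 by (simp add: has_bochner_integral_iff)
qed

lemma nn_integral_lborel_affine:
  fixes f :: "'a::euclidean_space \<Rightarrow> ennreal"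
  assumes [measurable]: "f \<in> borel_measurable borel" and "c \<noteq> 0"
  shows "(\<integral>\<^sup>+x. f x \<partial>lborel)
        = \<bar>c\<bar> ^ DIM('a) * (\<integral>\<^sup>+x. f (t + c *\<^sub>R x) \<partial>lborel)"
  by (subst lborel_affine[OF \<open>c \<noteq> 0\<close>, of t])
    (simp add: nn_integral_density nn_integral_distr nn_integral_cmult ennreal_power)

lemma has_bochner_integral_lborel_scale:
  fixes f :: "'a::euclidean_space \<Rightarrow> complex"
  assumes "has_bochner_integral lborel f v" and c: "c \<noteq> 0"
  shows "has_bochner_integral lborel (\<lambda>x. f (c *\<^sub>R x)) (v / \<bar>c\<bar> ^ DIM('a))"
proof -
  have f [measurable]: "f \<in> borel_measurable borel"
    using assms by (auto simp: has_bochner_integral_iff)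
  let ?D = "density (distr lborel borel (\<lambda>x::'a. 0 + c *\<^sub>R x)) (\<lambda>_. ennreal (\<bar>c\<bar> ^ DIM('a)))"
  have "has_bochner_integral ?D f v"
    using assms(1) lborel_affine[OF c, of 0] by metis
  then have "has_bochner_integral lborel (\<lambda>x. complex_of_real (\<bar>c\<bar> ^ DIM('a)) * f (c *\<^sub>R x)) v"
    by (auto simp: has_bochner_integral_iff integrable_density integral_density integrable_distr_eq integral_distr scaleR_conv_of_real)
  from has_bochner_integral_mult_right[OF this, of "1 / complex_of_real (\<bar>c\<bar> ^ DIM('a))"]
  show ?thesis using c by simp
qed

lemma has_bochner_integral_scaled_gaussian_fourier:
  fixes y :: "'a::euclidean_space"
  assumes "\<epsilon> > 0"
  shows "has_bochner_integral lborel
     (\<lambda>x. complex_of_real (exp (- (\<epsilon> * norm x)\<^sup>2 / 2)) * exp (\<i> * complex_of_real (x \<bullet> y)))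
     (complex_of_real ((sqrt (2 * pi) / \<epsilon>) ^ DIM('a) * exp (- (norm y / \<epsilon>)\<^sup>2 / 2)))"
proof -
  have "\<epsilon> \<noteq> 0" using assms by simp
  from has_bochner_integral_lborel_scale[OF has_bochner_integral_gaussian_fourier[of "y /\<^sub>R \<epsilon>"] this]
  have "has_bochner_integral lborel
     (\<lambda>x. complex_of_real (exp (- (norm (\<epsilon> *\<^sub>R x))\<^sup>2 / 2)) * exp (\<i> * complex_of_real ((\<epsilon> *\<^sub>R x) \<bullet> (y /\<^sub>R \<epsilon>))))
     (complex_of_real (sqrt (2 * pi) ^ DIM('a) * exp (- (norm (y /\<^sub>R \<epsilon>))\<^sup>2 / 2)) / \<bar>\<epsilon>\<bar> ^ DIM('a))" .
  moreover have nf: "norm (\<epsilon> *\<^sub>R x) = \<epsilon>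
        * norm x" "(\<epsilon> *\<^sub>R x) \<bullet> (y /\<^sub>R \<epsilon>) = x \<bullet> y"
    "norm (y /\<^sub>R \<epsilon>) = norm y / \<epsilon>" for x :: 'a
    using assms by (simp_all add: divide_inverse mult.commute)
  ultimately show ?thesis
    unfolding nf using assms by (simp add: power_divide)
qed

section \<open>Mollified measures and their averages over rays\<close>

text \<open>
  This is the Fourier transform of the Gaussian of width \<open>1 / \<epsilon>\<close>, in the normalisation with
  \<open>2 * pi\<close> in the exponent: the dilates of one probability density, concentrating at the
  origin as \<open>\<epsilon>\<close> tends to \<open>0\<close>.
\<close>

definition mollifier :: "real \<Rightarrow> 'a::euclidean_space \<Rightarrow> real" where
  "mollifier \<epsilon> y = (sqrt (2 * pi) / \<epsilon>) ^ DIM('a) * exp (- (2 * pi * norm y / \<epsilon>)\<^sup>2 / 2)"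

lemma mollifier_nonneg: "\<epsilon> > 0 \<Longrightarrow> mollifier \<epsilon> y \<ge> 0"
  by (simp add: mollifier_def)

lemma borel_measurable_mollifier [measurable]: "mollifier \<epsilon> \<in> borel_measurable borel"
  unfolding mollifier_def by measurable

lemma mollifier_scale: "\<epsilon> > 0 \<Longrightarrow> \<epsilon> ^ DIM('a)
      * mollifier \<epsilon> (\<epsilon> *\<^sub>R y) = mollifier 1 (y :: 'a::euclidean_space)"
  by (simp add: mollifier_def power_divide power_mult_distrib)

lemma integrable_gaussian_weight:
  assumes "\<epsilon> > 0"
  shows "integrable lborel (\<lambda>\<xi>::'a::euclidean_space. exp (- (\<epsilon> * norm \<xi>)\<^sup>2 / 2))"
  using has_bochner_integral_scaled_gaussian_fourier[OF assms, of "0::'a"]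
  by (simp add: has_bochner_integral_iff complex_of_real_integrable_eq)

lemma integrable_product_bounded:
  fixes f :: "'a \<times> 'b \<Rightarrow> 'c::{banach, second_countable_topology}" and b :: "'a \<Rightarrow> real" and a :: "'b \<Rightarrow> real"
  assumes "sigma_finite_measure N" "sigma_finite_measure L" and b: "integrable N b" and a: "integrable L a"
    and f [measurable]: "f \<in> borel_measurable (N \<Otimes>\<^sub>M L)" and le: "\<And>x y. norm (f (x, y))
          \<le> norm (b x) * norm (a y)"
  shows "integrable (N \<Otimes>\<^sub>M L) f"
proof -
  interpret N: sigma_finite_measure N by fact
  interpret L: sigma_finite_measure L by fact
  interpret pair_sigma_finite N L ..
  have [measurable]: "a \<in> borel_measurable L" "b \<in> borel_measurable N" using a b by auto
  show ?thesis
  proof (rule integrableI_bounded[OF f])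
    have "(\<integral>\<^sup>+ p. ennreal (norm (f p)) \<partial>(N \<Otimes>\<^sub>M L))
          = (\<integral>\<^sup>+ x. \<integral>\<^sup>+ y. ennreal (norm (f (x, y))) \<partial>L \<partial>N)"
      by (subst L.nn_integral_fst[symmetric]) simp_all
    also have "\<dots> \<le> (\<integral>\<^sup>+ x. \<integral>\<^sup>+ y. ennreal (norm (b x))
          * ennreal (norm (a y)) \<partial>L \<partial>N)"
      using le by (intro nn_integral_mono) (simp add: ennreal_mult'[symmetric])
    also have "\<dots> = (\<integral>\<^sup>+ x. ennreal (norm (b x)) \<partial>N)
          * (\<integral>\<^sup>+ y. ennreal (norm (a y)) \<partial>L)"
      by (simp add: nn_integral_cmult nn_integral_multc)
    also have "\<dots> < \<infinity>"
      using integrable_iff_bounded[of N b] integrable_iff_bounded[of L a] a b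
      by (simp only: infinity_ennreal_def ennreal_mult_less_top simp_thms)
    finally show "(\<integral>\<^sup>+ p. ennreal (norm (f p)) \<partial>(N \<Otimes>\<^sub>M L)) < \<infinity>" .
  qed
qed

lemma borel_measurable_fourier_transform:
  fixes N :: "(real^'n) measure"
  assumes "finite_measure N" and sets: "sets N = sets borel"
  shows "fourier_transform N \<in> borel_measurable borel"
proof -
  interpret finite_measure N by fact
  note [measurable_cong] = sets
  show ?thesis unfolding fourier_transform_def by measurable
qed

lemma norm_exp_i_of_real [simp]: "cmod (exp (\<i> * complex_of_real r)) = 1"
  by (simp add: norm_exp_eq_Re)

text \<open>
  Fourier inversion for the convolution of \<open>N\<close> with the mollifier. The
  Gaussian factor makes the double integral absolutely convergent for every finite measure \<open>N\<close>, so
  that Fubini's theorem applies.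
\<close>

lemma mollified_measure_eq:
  fixes N :: "(real^'n) measure"
  assumes N: "finite_measure N" and sets: "sets N = sets borel" and "\<epsilon> > 0"
  shows "complex_of_real (LINT w|N. mollifier \<epsilon> (y - w)) =
    (LINT \<xi>|lborel. complex_of_real (exp (- (\<epsilon> * norm \<xi>)\<^sup>2 / 2)) *
       exp (\<i> * complex_of_real (2 * pi * (y \<bullet> \<xi>))) * fourier_transform N \<xi>)"
proof -
  interpret N: finite_measure N by fact
  interpret pair_sigma_finite N "lborel :: (real^'n) measure" ..
  note [measurable_cong] = sets
  let ?k = "\<lambda>w \<xi>::real^'n. complex_of_real (exp (- (\<epsilon> * norm \<xi>)\<^sup>2 / 2)) * exp (\<i>
        * complex_of_real (\<xi> \<bullet> ((2 * pi) *\<^sub>R (y - w))))"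
  have [measurable]: "case_prod ?k \<in> borel_measurable (N \<Otimes>\<^sub>M lborel)"
    by measurable
  have int: "integrable (N \<Otimes>\<^sub>M lborel) (case_prod ?k)"
    by (rule integrable_product_bounded[OF _ _ N.integrable_const[of "1::real"] integrable_gaussian_weight[OF \<open>\<epsilon> > 0\<close>]])
      (auto simp: norm_mult sigma_finite_lborel intro: N.sigma_finite_measure_axioms)
  have "(LINT \<xi>|lborel. ?k w \<xi>) = complex_of_real (mollifier \<epsilon> (y - w))" for w
    using has_bochner_integral_scaled_gaussian_fourier[OF \<open>\<epsilon> > 0\<close>, of "(2 * pi) *\<^sub>R (y - w)"]
    by (simp add: has_bochner_integral_iff mollifier_def)
  then have "complex_of_real (LINT w|N. mollifier \<epsilon> (y - w)) = (LINT w|N. LINT \<xi>|lborel. ?k w \<xi>)"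
    by simp
  also have "\<dots> = (LINT \<xi>|lborel. LINT w|N. ?k w \<xi>)"
    by (rule Fubini_integral[OF int, symmetric])
  also have "\<dots> = (LINT \<xi>|lborel. complex_of_real (exp (- (\<epsilon> * norm \<xi>)\<^sup>2 / 2)) *
       exp (\<i> * complex_of_real (2 * pi * (y \<bullet> \<xi>))) * fourier_transform N \<xi>)"
  proof (intro Bochner_Integration.integral_cong refl)
    fix \<xi> :: "real^'n"
    have "?k w \<xi> = complex_of_real (exp (- (\<epsilon> * norm \<xi>)\<^sup>2 / 2)) *
       exp (\<i> * complex_of_real (2 * pi * (y \<bullet> \<xi>))) * exp (- 2 * complex_of_real pi * \<i> * complex_of_real (w \<bullet> \<xi>))" for w
      by (simp add: mult.assoc exp_add[symmetric] inner_diff_right inner_diff_left inner_commute algebra_simps)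
    then show "(LINT w|N. ?k w \<xi>) = complex_of_real (exp (- (\<epsilon> * norm \<xi>)\<^sup>2 / 2)) *
       exp (\<i> * complex_of_real (2 * pi * (y \<bullet> \<xi>))) * fourier_transform N \<xi>"
      by (simp add: fourier_transform_def)
  qed
  finally show ?thesis .
qed

definition slab_weight :: "'a::euclidean_space \<Rightarrow> 'a \<Rightarrow> real" where
  "slab_weight z \<xi> = exp (- (2 * pi * (z \<bullet> \<xi>))\<^sup>2 / 2)"

text \<open>
  As a function of \<open>\<xi>\<close>, the weight is concentrated on the slab \<open>|z \<bullet> \<xi>| \<lesssim> 1\<close> around the hyperplane
  orthogonal to \<open>z\<close>; it is the transform of the Gaussian weight on the line through \<open>z\<close>.
\<close>

definition slab_integral :: "(real^'n) measure \<Rightarrow> real^'n \<Rightarrow> ennreal" where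
  "slab_integral N z = (\<integral>\<^sup>+\<xi>. ennreal (cmod (fourier_transform N \<xi>) * slab_weight z \<xi>)
        \<partial>lborel)"

lemma slab_weight_pos: "slab_weight z \<xi> > 0"
  by (simp add: slab_weight_def)

lemma slab_weight_le_1: "slab_weight z \<xi> \<le> 1"
  by (simp add: slab_weight_def)

lemma borel_measurable_slab_weight [measurable (raw)]:
  fixes f g :: "'b \<Rightarrow> 'a::euclidean_space"
  assumes [measurable]: "f \<in> borel_measurable M" "g \<in> borel_measurable M"
  shows "(\<lambda>x. slab_weight (f x) (g x)) \<in> borel_measurable M"
  unfolding slab_weight_def by measurable

lemma borel_measurable_slab_integral:
  fixes N :: "(real^'n) measure"
  assumes "finite_measure N" and "sets N = sets borel"
  shows "slab_integral N \<in> borel_measurable borel"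
proof -
  have [measurable]: "fourier_transform N \<in> borel_measurable borel"
    by (rule borel_measurable_fourier_transform[OF assms])
  show ?thesis unfolding slab_integral_def slab_weight_def by measurable
qed

text \<open>
  The average runs over the full line through \<open>z\<close>. The half-line opposite to \<open>z\<close> only enlarges a
  nonnegative quantity, and including it makes the transform of the weight an explicit Gaussian.
  The bound does not depend on \<open>\<epsilon>\<close>, which is what allows the passage to the limit below.
\<close>

lemma radial_average_mollified_le:
  fixes N :: "(real^'n) measure"
  assumes N: "finite_measure N" and sets: "sets N = sets borel" and e: "\<epsilon> > 0"
  shows "(\<integral>\<^sup>+t. ennreal (exp (- t\<^sup>2 / 2)
        * (LINT w|N. mollifier \<epsilon> (t *\<^sub>R z - w))) \<partial>lborel)
    \<le> ennreal (sqrt (2 * pi)) * slab_integral N z"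
proof -
  interpret finite_measure N by fact
  note [measurable_cong] = sets
  note [measurable] = borel_measurable_fourier_transform[OF N sets]
  let ?a = "\<lambda>\<xi>::real^'n. exp (- (\<epsilon> * norm \<xi>)\<^sup>2 / 2)"
  let ?F = "fourier_transform N"
  let ?g = "\<lambda>t. LINT w|N. mollifier \<epsilon> (t *\<^sub>R z - w)"
  (* Integrating this kernel over t gives the slab weight, over \<xi> the mollified measure. *)
  let ?k = "\<lambda>(t::real) \<xi>. complex_of_real (exp (- t\<^sup>2 / 2)) *
     (complex_of_real (?a \<xi>) * exp (\<i> * complex_of_real (2 * pi * ((t *\<^sub>R z) \<bullet> \<xi>))) * ?F \<xi>)"
  have F_le: "cmod (?F \<xi>) \<le> measure N (space N)" for \<xi>
  proof -
    have "cmod (?F \<xi>) \<le>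
      (LINT x|N. cmod (exp (- 2 * complex_of_real pi * \<i> * complex_of_real (x \<bullet> \<xi>))))"
      unfolding fourier_transform_def by (rule integral_norm_bound)
    then show ?thesis by (simp add: norm_exp_eq_Re)
  qed
  have Fs: "cmod (?F \<xi>) * slab_weight z \<xi> \<le> measure N (space N)" for \<xi>
    using mult_mono[OF F_le[of \<xi>] slab_weight_le_1[of z \<xi>]] slab_weight_pos[of z \<xi>] by simp
  have ti: "integrable lborel (\<lambda>t::real. exp (- t\<^sup>2 / 2))"
    using integrable_gaussian_weight[of 1, where 'a=real] by simp
  have int: "integrable (lborel \<Otimes>\<^sub>M lborel) (case_prod ?k)"
  proof (rule integrable_product_bounded[OF _ _ ti integrable_mult_left[OF integrable_gaussian_weight[OF e], of "measure N (space N)"]])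
    show "norm (case (t, \<xi>) of (t, \<xi>) \<Rightarrow> ?k t \<xi>)
          \<le> norm (exp (- t\<^sup>2 / 2)) * norm (?a \<xi> * measure N (space N))" for t \<xi>
      using F_le by (simp add: norm_mult mult_left_mono)
  qed (auto simp: sigma_finite_lborel)
  have inner_t: "(LINT \<xi>|lborel. ?k t \<xi>) = complex_of_real (exp (- t\<^sup>2 / 2) * ?g t)" for t
    unfolding integral_mult_right_zero mollified_measure_eq[OF N sets e, symmetric] by simp
  have inner_xi: "(LINT t|lborel. ?k t \<xi>) = complex_of_real (sqrt (2 * pi)) * (?F \<xi>
        * complex_of_real (?a \<xi> * slab_weight z \<xi>))" for \<xi>
  proof -
    have "(LINT t|lborel. ?k t \<xi>) = (LINT t|lborel. (?F \<xi> * complex_of_real (?a \<xi>)) *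
       (complex_of_real (exp (- t\<^sup>2 / 2)) * exp (\<i> * complex_of_real (t * (2 * pi * (z \<bullet> \<xi>))))))"
      by (intro Bochner_Integration.integral_cong refl) (simp add: mult_ac)
    also have "\<dots> = (?F \<xi> * complex_of_real (?a \<xi>)) * complex_of_real (sqrt (2 * pi) * slab_weight z \<xi>)"
      using has_bochner_integral_gaussian_fourier_real[of "2 * pi * (z \<bullet> \<xi>)"]
      by (simp add: has_bochner_integral_iff slab_weight_def)
    finally show ?thesis by (simp add: mult_ac)
  qed
  have g_nonneg: "?g t \<ge> 0" for t
    by (intro integral_nonneg_AE AE_I2 mollifier_nonneg e)
  have "integrable lborel (\<lambda>t. complex_of_real (exp (- t\<^sup>2 / 2) * ?g t))"
    using lborel_pair.integrable_fst'[OF int] by (simp only: prod.case inner_t)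
  then have gi: "integrable lborel (\<lambda>t. exp (- t\<^sup>2 / 2) * ?g t)"
    unfolding complex_of_real_integrable_eq .
  have "(\<integral>\<^sup>+t. ennreal (exp (- t\<^sup>2 / 2) * ?g t) \<partial>lborel)
        = ennreal (LINT t|lborel. exp (- t\<^sup>2 / 2) * ?g t)"
    using g_nonneg by (intro nn_integral_eq_integral gi) auto
  also have "\<dots> \<le> ennreal (cmod (complex_of_real (LINT t|lborel. exp (- t\<^sup>2 / 2) * ?g t)))"
    by (intro ennreal_leI) (simp add: norm_of_real)
  also have "complex_of_real (LINT t|lborel. exp (- t\<^sup>2 / 2) * ?g t) = (LINT t|lborel. LINT \<xi>|lborel. ?k t \<xi>)"
    unfolding inner_t by (simp only: integral_complex_of_real)
  also have "\<dots> = (LINT \<xi>|lborel. LINT t|lborel. ?k t \<xi>)"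
    by (rule lborel_pair.Fubini_integral[OF int, symmetric])
  also have "\<dots> = complex_of_real (sqrt (2 * pi)) * (LINT \<xi>|lborel. ?F \<xi> * complex_of_real (?a \<xi>
        * slab_weight z \<xi>))"
    unfolding inner_xi by simp
  also have "ennreal (cmod \<dots>) = ennreal (sqrt (2 * pi)) * ennreal (cmod (LINT \<xi>|lborel. ?F \<xi>
        * complex_of_real (?a \<xi> * slab_weight z \<xi>)))"
    by (simp add: norm_mult ennreal_mult)
  also have "\<dots> \<le> ennreal (sqrt (2 * pi)) *
     (\<integral>\<^sup>+\<xi>. ennreal (norm (?F \<xi> * complex_of_real (?a \<xi> * slab_weight z \<xi>))) \<partial>lborel)"
  proof (intro mult_left_mono integral_norm_bound_ennreal)
    show "integrable lborel (\<lambda>\<xi>. ?F \<xi> * complex_of_real (?a \<xi> * slab_weight z \<xi>))"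
    proof (rule Bochner_Integration.integrable_bound)
      show "integrable lborel (\<lambda>\<xi>. ?a \<xi> * measure N (space N))"
        by (intro integrable_mult_left integrable_gaussian_weight e)
      show "AE \<xi> in lborel. norm (?F \<xi> * complex_of_real (?a \<xi> * slab_weight z \<xi>))
            \<le> norm (?a \<xi> * measure N (space N))"
        using Fs slab_weight_pos[of z]
        by (intro AE_I2) (simp add: norm_mult abs_of_pos mult_ac)
    qed measurable
  qed simp
  also have "\<dots> \<le> ennreal (sqrt (2 * pi)) * slab_integral N z"
    unfolding slab_integral_def
    using slab_weight_pos[of z] by (intro mult_left_mono nn_integral_mono ennreal_leI) (simp_all add: norm_mult abs_of_pos mult_left_mono mult_left_le_one_le)
  finally show ?thesis .
qed

section \<open>Domination of the radial projection by slab integrals\<close>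

lemma nn_integral_mollifier: "(\<integral>\<^sup>+v. ennreal (mollifier 1 (v::'a::euclidean_space)) \<partial>lborel) = 1"
proof -
  have h: "has_bochner_integral lborel (\<lambda>v::'a. exp (- (2 * pi * norm v)\<^sup>2 / 2)) ((sqrt (2 * pi) / (2
        * pi)) ^ DIM('a))"
    using has_bochner_integral_scaled_gaussian_fourier[of "2 * pi" "0::'a"]
      integral_complex_of_real[of lborel "\<lambda>v::'a. exp (- (2 * pi * norm v)\<^sup>2 / 2)"]
    by (simp add: has_bochner_integral_iff complex_of_real_integrable_eq flip: of_real_power of_real_divide of_real_mult)
  have "has_bochner_integral lborel (mollifier 1 :: 'a \<Rightarrow> real) (sqrt (2 * pi) ^ DIM('a) * (sqrt (2
        * pi) / (2 * pi)) ^ DIM('a))"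
    using has_bochner_integral_mult_right[OF h, of "sqrt (2 * pi) ^ DIM('a)"]
    unfolding mollifier_def by simp
  also have "sqrt (2 * pi) ^ DIM('a) * (sqrt (2 * pi) / (2 * pi)) ^ DIM('a) = 1"
    by (simp flip: power_mult_distrib)
  finally show ?thesis
    by (subst nn_integral_eq_integral) (auto simp: has_bochner_integral_iff mollifier_nonneg)
qed

lemma radial_proj_scale: "t > 0 \<Longrightarrow> radial_proj 0 (t *\<^sub>R z) = radial_proj 0 z"
  by (simp add: radial_proj_def)

lemma borel_measurable_radial_proj [measurable]:
  "radial_proj x \<in> borel_measurable (borel :: 'a::euclidean_space measure)"
  unfolding radial_proj_def by measurable

text \<open>
  For \<open>t\<close> in \<open>[C, C + 1]\<close> division by \<open>t\<close> maps the part of a cone in the ball of radius \<open>C\<close> into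
  the unit ball and keeps directions. Averaging this change of variables over all such \<open>t\<close>
  compares an integral over a cone with integrals over rays. The constant is the least value of
  \<open>exp (- t\<^sup>2 / 2) / t ^ n\<close> on that interval.
\<close>

lemma cone_integral_le:
  fixes g :: "'a::euclidean_space \<Rightarrow> ennreal" and V :: "'a set"
  assumes [measurable]: "g \<in> borel_measurable borel" "V \<in> sets borel" and C: "C > 0"
  shows "ennreal (exp (- (C + 1)\<^sup>2 / 2) / (C + 1) ^ DIM('a)) *
      (\<integral>\<^sup>+y. indicator {y \<in> ball 0 C. radial_proj 0 y \<in> V} y * g y \<partial>lborel)
    \<le> (\<integral>\<^sup>+z. indicator {z \<in> ball 0 1. radial_proj 0 z \<in> V} z *
        (\<integral>\<^sup>+t. ennreal (exp (- t\<^sup>2 / 2)) * g (t *\<^sub>R z) \<partial>lborel) \<partial>lborel)"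
proof -
  define S where "S = {z \<in> ball 0 1. radial_proj 0 z \<in> V}"
  have [measurable]: "S \<in> sets borel" "{y \<in> ball 0 C. radial_proj 0 y \<in> V} \<in> sets borel"
    unfolding S_def by measurable
  let ?\<Phi> = "\<lambda>y. indicator {y \<in> ball 0 C. radial_proj 0 y \<in> V} y * g y"
  let ?H = "indicator S :: 'a \<Rightarrow> ennreal"
  let ?\<kappa> = "exp (- (C + 1)\<^sup>2 / 2) / (C + 1) ^ DIM('a)"
  have slice: "ennreal ?\<kappa> * (\<integral>\<^sup>+y. ?\<Phi> y \<partial>lborel)
        \<le> ennreal (exp (- t\<^sup>2 / 2)) * (\<integral>\<^sup>+z. ?H z * g (t *\<^sub>R z) \<partial>lborel)"
    if t: "t \<in> {C..C + 1}" for t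
  proof -
    have t0: "t > 0" using t C by auto
    have "(\<integral>\<^sup>+y. ?\<Phi> y \<partial>lborel)
          = ennreal (t ^ DIM('a)) * (\<integral>\<^sup>+z. ?\<Phi> (0 + t *\<^sub>R z) \<partial>lborel)"
      using nn_integral_lborel_affine[of ?\<Phi> t 0] t0 by (simp add: ennreal_power)
    also have "\<dots> \<le> ennreal ((C + 1) ^ DIM('a)) * (\<integral>\<^sup>+z. ?H z * g (t *\<^sub>R z) \<partial>lborel)"
    proof (rule mult_mono)
      show "ennreal (t ^ DIM('a)) \<le> ennreal ((C + 1) ^ DIM('a))"
        using t t0 by (intro ennreal_leI power_mono) auto
      show "(\<integral>\<^sup>+z. ?\<Phi> (0 + t *\<^sub>R z) \<partial>lborel)
            \<le> (\<integral>\<^sup>+z. ?H z * g (t *\<^sub>R z) \<partial>lborel)"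
      proof (rule nn_integral_mono)
        fix z :: 'a
        have "z \<in> ball 0 1" if "t *\<^sub>R z \<in> ball 0 C"
        proof -
          have "t * norm z < C" using that t0 by simp
          also have "C \<le> t * 1" using t by simp
          finally have "t * norm z < t * 1" .
          then show ?thesis using t0 by (simp only: mult_less_cancel_left_pos) simp
        qed
        then show "?\<Phi> (0 + t *\<^sub>R z) \<le> ?H z * g (t *\<^sub>R z)"
          using t0 by (auto simp: indicator_def radial_proj_scale S_def)
      qed
    qed simp_all
    finally have "ennreal ?\<kappa> * (\<integral>\<^sup>+y. ?\<Phi> y \<partial>lborel)
          \<le> ennreal ?\<kappa> * (ennreal ((C + 1) ^ DIM('a)) * (\<integral>\<^sup>+z. ?H z
          * g (t *\<^sub>R z) \<partial>lborel))"
      by (rule mult_left_mono) simp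
    also have "\<dots> = ennreal (exp (- (C + 1)\<^sup>2 / 2)) * (\<integral>\<^sup>+z. ?H z * g (t *\<^sub>R z)
          \<partial>lborel)"
      using C by (simp add: mult.assoc[symmetric] ennreal_mult[symmetric])
    also have "\<dots> \<le> ennreal (exp (- t\<^sup>2 / 2)) * (\<integral>\<^sup>+z. ?H z * g (t *\<^sub>R z) \<partial>lborel)"
      using t t0 by (intro mult_right_mono ennreal_leI) (auto intro!: power_mono)
    finally show ?thesis .
  qed
  have "ennreal ?\<kappa> * (\<integral>\<^sup>+y. ?\<Phi> y \<partial>lborel)
        = (\<integral>\<^sup>+t. indicator {C..C + 1} t * (ennreal ?\<kappa>
        * (\<integral>\<^sup>+y. ?\<Phi> y \<partial>lborel)) \<partial>lborel)"
    by (simp add: nn_integral_multc)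
  also have "\<dots> \<le> (\<integral>\<^sup>+t. ennreal (exp (- t\<^sup>2 / 2)) * (\<integral>\<^sup>+z. ?H z
        * g (t *\<^sub>R z) \<partial>lborel) \<partial>lborel)"
    using slice by (intro nn_integral_mono) (simp add: indicator_def)
  also have "\<dots> = (\<integral>\<^sup>+t. \<integral>\<^sup>+z. ?H z * (ennreal (exp (- t\<^sup>2 / 2))
        * g (t *\<^sub>R z)) \<partial>lborel \<partial>lborel)"
    by (intro nn_integral_cong, subst nn_integral_cmult[symmetric]) (simp_all add: mult_ac)
  also have "\<dots> = (\<integral>\<^sup>+z. \<integral>\<^sup>+t. ?H z * (ennreal (exp (- t\<^sup>2 / 2))
        * g (t *\<^sub>R z)) \<partial>lborel \<partial>lborel)"
    by (rule lborel_pair.Fubini'[symmetric]) measurable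
  also have "\<dots> = (\<integral>\<^sup>+z. ?H z * (\<integral>\<^sup>+t. ennreal (exp (- t\<^sup>2 / 2))
        * g (t *\<^sub>R z) \<partial>lborel) \<partial>lborel)"
    by (simp add: nn_integral_cmult)
  finally show ?thesis unfolding S_def .
qed

text \<open>
  Mollified measures converge weakly, so their masses of an open set are asymptotically at least
  the mass of the limit. Here this is Fatou's lemma after the substitution \<open>y = w + \<epsilon> v\<close>, since the
  indicator of an open set is lower semicontinuous.
\<close>

lemma emeasure_open_le_mollified:
  fixes N :: "'a::euclidean_space measure"
  assumes N: "finite_measure N" and sets: "sets N = sets borel" and O: "open U"
    and bound: "\<And>\<epsilon>. \<epsilon> > 0 \<Longrightarrow> (\<integral>\<^sup>+y. indicator U y
          * ennreal (LINT w|N. mollifier \<epsilon> (y - w)) \<partial>lborel) \<le> B"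
  shows "emeasure N U \<le> B"
proof -
  interpret N: finite_measure N by fact
  interpret pair_sigma_finite N "lborel :: 'a measure" ..
  note [measurable_cong] = sets
  have [measurable]: "U \<in> sets borel" using O by auto
  define e where "e m = 1 / real (Suc m)" for m
  have e: "e m > 0" for m by (simp add: e_def)
  have e0: "e \<longlonglongrightarrow> 0" unfolding e_def by (rule LIMSEQ_Suc[OF lim_1_over_n])
  let ?I = "\<lambda>m w. \<integral>\<^sup>+v. indicator U (w + e m *\<^sub>R v) * ennreal (mollifier 1 v) \<partial>lborel"
  have I_le: "(\<integral>\<^sup>+w. ?I m w \<partial>N) \<le> B" for m
  proof -
    have "integrable N (\<lambda>w. mollifier (e m) (y - w))" for y
    proof (rule N.integrable_const_bound)
      show "AE w in N. norm (mollifier (e m) (y - w)) \<le> (sqrt (2 * pi) / e m) ^ DIM('a)"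
        using e[of m] by (intro AE_I2) (simp add: mollifier_def)
    qed measurable
    then have g: "ennreal (LINT w|N. mollifier (e m) (y - w))
          = (\<integral>\<^sup>+w. ennreal (mollifier (e m) (y - w)) \<partial>N)" for y
      by (intro nn_integral_eq_integral[symmetric]) (auto simp: mollifier_nonneg e)
    have "?I m w = (\<integral>\<^sup>+y. indicator U y * ennreal (mollifier (e m) (y - w)) \<partial>lborel)" for w
    proof -
      have "(\<integral>\<^sup>+y. indicator U y * ennreal (mollifier (e m) (y - w)) \<partial>lborel) =
        (ennreal (e m) ^ DIM('a)) * (\<integral>\<^sup>+v. indicator U (w + e m *\<^sub>R v) * ennreal (mollifier (e m) (e m *\<^sub>R v)) \<partial>lborel)"
        using e[of m] by (subst nn_integral_lborel_affine[of _ "e m" w]) (auto simp: ennreal_power)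
      also have "\<dots> = (\<integral>\<^sup>+v. indicator U (w + e m *\<^sub>R v) * ennreal (e m ^ DIM('a)
            * mollifier (e m) (e m *\<^sub>R v)) \<partial>lborel)"
        using e[of m] by (subst nn_integral_cmult[symmetric]) (auto simp: mult_ac ennreal_mult ennreal_power mollifier_nonneg)
      finally show ?thesis by (simp only: mollifier_scale[OF e])
    qed
    then have "(\<integral>\<^sup>+w. ?I m w \<partial>N)
          = (\<integral>\<^sup>+w. \<integral>\<^sup>+y. indicator U y
          * ennreal (mollifier (e m) (y - w)) \<partial>lborel \<partial>N)"
      by simp
    also have "\<dots> = (\<integral>\<^sup>+y. \<integral>\<^sup>+w. indicator U y
          * ennreal (mollifier (e m) (y - w)) \<partial>N \<partial>lborel)"
      by (rule Fubini'[symmetric]) measurable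
    also have "\<dots> = (\<integral>\<^sup>+y. indicator U y * ennreal (LINT w|N. mollifier (e m) (y - w)) \<partial>lborel)"
      unfolding g by (intro nn_integral_cong nn_integral_cmult) measurable
    also have "\<dots> \<le> B" by (rule bound[OF e])
    finally show ?thesis .
  qed
  have "emeasure N U = (\<integral>\<^sup>+w. \<integral>\<^sup>+v. indicator U w * ennreal (mollifier 1 (v::'a))
        \<partial>lborel \<partial>N)"
    by (simp add: nn_integral_cmult nn_integral_mollifier)
  also have "\<dots> \<le> (\<integral>\<^sup>+w. \<integral>\<^sup>+v. liminf (\<lambda>m. indicator U (w
        + e m *\<^sub>R v) * ennreal (mollifier 1 v)) \<partial>lborel \<partial>N)"
  proof (intro nn_integral_mono Liminf_bounded)
    fix w v :: 'a
    show "\<forall>\<^sub>F m in sequentially. indicator U w * ennreal (mollifier 1 v)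
          \<le> indicator U (w + e m *\<^sub>R v) * ennreal (mollifier 1 v)"
    proof (cases "w \<in> U")
      case True
      have "(\<lambda>m. w + e m *\<^sub>R v) \<longlonglongrightarrow> w + 0 *\<^sub>R v"
        by (intro tendsto_intros e0)
      then have "\<forall>\<^sub>F m in sequentially. w + e m *\<^sub>R v \<in> U"
        using topological_tendstoD[OF _ O] True by force
      then show ?thesis by eventually_elim (simp add: True)
    qed simp
  qed
  also have "\<dots> \<le> (\<integral>\<^sup>+w. liminf (\<lambda>m. ?I m w) \<partial>N)"
    by (intro nn_integral_mono nn_integral_liminf) measurable
  also have "\<dots> \<le> liminf (\<lambda>m. \<integral>\<^sup>+w. ?I m w \<partial>N)"
    by (rule nn_integral_liminf) measurable
  also have "\<dots> \<le> B"
    by (rule Liminf_le) (simp_all add: I_le)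
  finally show ?thesis .
qed

text \<open>
  The three preceding estimates, applied to the part of the open cone over \<open>V\<close> inside the ball of
  radius \<open>C\<close>. The origin has to be removed from the cone to make it open.
\<close>

lemma emeasure_open_cone_le:
  fixes N :: "(real^'n) measure"
  assumes N: "finite_measure N" and sets: "sets N = sets borel" and C: "C > 0"
    and null: "emeasure N {0} = 0" "emeasure N (- ball 0 C) = 0" and V: "open V"
  shows "emeasure N {w. radial_proj 0 w \<in> V} \<le>
    ennreal (sqrt (2 * pi) * (C + 1) ^ CARD('n) * exp ((C + 1)\<^sup>2 / 2)) *
    (\<integral>\<^sup>+z. indicator {z \<in> ball 0 1. radial_proj 0 z \<in> V} z * slab_integral N z \<partial>lborel)"
    (is "_ \<le> ennreal ?K * ?X")
proof -
  interpret N: finite_measure N by fact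
  note [measurable_cong] = sets
  note [measurable] = borel_measurable_slab_integral[OF N sets]
  have [measurable]: "V \<in> sets borel" using V by auto
  define S where "S = {z \<in> ball 0 1. radial_proj (0::real^'n) z \<in> V}"
  have [measurable]: "S \<in> sets borel" unfolding S_def by measurable
  define U where "U = {w \<in> ball 0 C - {0}. radial_proj (0::real^'n) w \<in> V}"
  have "continuous_on (ball 0 C - {0::real^'n}) (radial_proj 0)"
    unfolding radial_proj_def by (intro continuous_intros) auto
  then have "open U"
    using continuous_open_preimage[of "ball 0 C - {0::real^'n}" "radial_proj 0" V] V
    by (auto simp: U_def vimage_def Int_def open_delete)
  define \<kappa> where "\<kappa> = exp (- (C + 1)\<^sup>2 / 2) / (C + 1) ^ CARD('n)"
  have \<kappa>: "\<kappa> > 0" using C by (simp add: \<kappa>_def)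
  have \<kappa>K: "1 / \<kappa> * sqrt (2 * pi) = ?K"
  proof -
    have "exp (- (C + 1)\<^sup>2 / 2) = inverse (exp ((C + 1)\<^sup>2 / 2))"
      by (simp only: minus_divide_left[symmetric] exp_minus)
    then show ?thesis unfolding \<kappa>_def by (simp only:) (simp add: divide_simps)
  qed
  have bound: "(\<integral>\<^sup>+y. indicator U y * ennreal (LINT w|N. mollifier \<epsilon> (y - w))
        \<partial>lborel) \<le> ennreal ?K * ?X"
    if e: "\<epsilon> > 0" for \<epsilon>
  proof -
    let ?g = "\<lambda>y. ennreal (LINT w|N. mollifier \<epsilon> (y - w))"
    let ?J = "\<integral>\<^sup>+y. indicator {y \<in> ball 0 C. radial_proj 0 y \<in> V} y * ?g y \<partial>lborel"
    have nonneg: "(LINT w|N. mollifier \<epsilon> (y - w)) \<ge> 0" for y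
      by (intro integral_nonneg_AE AE_I2 mollifier_nonneg e)
    have "ennreal \<kappa> * ?J \<le> (\<integral>\<^sup>+z. indicator S z
          * (\<integral>\<^sup>+t. ennreal (exp (- t\<^sup>2 / 2)) * ?g (t *\<^sub>R z) \<partial>lborel) \<partial>lborel)"
      using cone_integral_le[of ?g V C] C unfolding S_def \<kappa>_def by simp
    also have "\<dots> \<le> (\<integral>\<^sup>+z. indicator S z * (ennreal (sqrt (2 * pi)) * slab_integral N z)
          \<partial>lborel)"
      using radial_average_mollified_le[OF N sets e]
      by (intro nn_integral_mono mult_left_mono) (simp_all add: ennreal_mult'[OF nonneg] ennreal_mult nonneg)
    also have "\<dots> = ennreal (sqrt (2 * pi)) * ?X"
      unfolding S_def[symmetric] by (subst nn_integral_cmult[symmetric]) (auto simp: mult_ac)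
    finally have "ennreal (1 / \<kappa>) * (ennreal \<kappa> * ?J) \<le> ennreal (1 / \<kappa>) * (ennreal (sqrt (2 * pi)) * ?X)"
      by (rule mult_left_mono) simp
    also have "ennreal (1 / \<kappa>) * (ennreal \<kappa> * ?J) = ?J"
      using \<kappa> by (subst mult.assoc[symmetric], subst ennreal_mult[symmetric]) simp_all
    also have "ennreal (1 / \<kappa>) * (ennreal (sqrt (2 * pi)) * ?X) = ennreal ?K * ?X"
      using \<kappa> by (subst mult.assoc[symmetric], subst ennreal_mult[symmetric]) (simp_all only: \<kappa>K, simp_all)
    finally have "?J \<le> ennreal ?K * ?X" .
    moreover have "(\<integral>\<^sup>+y. indicator U y * ?g y \<partial>lborel) \<le> ?J"
      by (intro nn_integral_mono mult_right_mono) (auto simp: U_def indicator_def)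
    ultimately show ?thesis by (rule order_trans[rotated])
  qed
  have [measurable]: "U \<in> sets borel" using \<open>open U\<close> by auto
  have "emeasure N {w. radial_proj 0 w \<in> V} \<le> emeasure N (U \<union> ({0} \<union> - ball 0 C))"
    by (intro emeasure_mono) (auto simp: U_def sets)
  also have "\<dots> = emeasure N U"
  proof -
    have "{0} \<in> null_sets N" "- ball 0 C \<in> null_sets N"
      using null by (auto simp: null_sets_def sets)
    then show ?thesis by (intro emeasure_Un_null_set null_sets.Un) (simp_all add: sets)
  qed
  also have "\<dots> \<le> ennreal ?K * ?X"
    by (rule emeasure_open_le_mollified[OF N sets \<open>open U\<close> bound])
  finally show ?thesis .
qed

text \<open>
  For indicator functions \<open>h\<close>, both sides are finite Borel measures, so the inequality for open sets
  passes to Borel sets by outer regularity of the right side. The finiteness hypothesis is there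
  for this step.
\<close>

lemma nn_integral_radial_proj_le:
  fixes N :: "(real^'n) measure"
  assumes N: "finite_measure N" and sets: "sets N = sets borel" and C: "C > 0"
    and null: "emeasure N {0} = 0" "emeasure N (- ball 0 C) = 0"
    and fin: "(\<integral>\<^sup>+z. indicator (ball 0 1) z * slab_integral N z \<partial>lborel) < \<infinity>"
    and h [measurable]: "h \<in> borel_measurable borel"
  shows "(\<integral>\<^sup>+w. h (radial_proj 0 w) \<partial>N) \<le>
    ennreal (sqrt (2 * pi) * (C + 1) ^ CARD('n) * exp ((C + 1)\<^sup>2 / 2)) *
    (\<integral>\<^sup>+z. indicator (ball 0 1) z * (h (radial_proj 0 z) * slab_integral N z) \<partial>lborel)"
proof -
  interpret N: finite_measure N by fact
  note [measurable_cong] = sets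
  note [measurable] = borel_measurable_slab_integral[OF N sets]
  have [measurable]: "ball (0::real^'n) 1 \<in> sets borel" by simp
  have sp: "space N = UNIV" using sets_eq_imp_space_eq[OF sets] by simp
  let ?P = "radial_proj (0 :: real^'n)"
  let ?K = "ennreal (sqrt (2 * pi) * (C + 1) ^ CARD('n) * exp ((C + 1)\<^sup>2 / 2))"
  let ?d = "density lborel (\<lambda>z. indicator (ball 0 1) z * slab_integral N z)"
  define \<alpha> where "\<alpha> = distr N borel ?P"
  define \<beta> where "\<beta> = scale_measure ?K (distr ?d borel ?P)"
  have [simp]: "sets \<alpha> = sets borel" "sets \<beta> = sets borel" "space \<beta> = UNIV"
    by (auto simp: \<alpha>_def \<beta>_def space_scale_measure)
  have \<alpha>: "emeasure \<alpha> A = emeasure N {w. ?P w \<in> A}" if "A \<in> sets borel" for A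
    using that by (simp add: \<alpha>_def emeasure_distr sp vimage_def)
  have \<beta>: "emeasure \<beta> A = ?K * (\<integral>\<^sup>+z. indicator {z \<in> ball 0 1. ?P z \<in> A} z
        * slab_integral N z \<partial>lborel)"
    if [measurable]: "A \<in> sets borel" for A
  proof -
    have [measurable]: "{z. ?P z \<in> A} \<in> sets borel" by measurable
    have "emeasure (distr ?d borel ?P) A = emeasure ?d {z. ?P z \<in> A}"
      by (subst emeasure_distr) (auto simp: vimage_def)
    also have "\<dots> = (\<integral>\<^sup>+z. indicator (ball 0 1) z * slab_integral N z
          * indicator {z. ?P z \<in> A} z \<partial>lborel)"
      by (rule emeasure_density) simp_all
    also have "\<dots> = (\<integral>\<^sup>+z. indicator {z \<in> ball 0 1. ?P z \<in> A} z * slab_integral N z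
          \<partial>lborel)"
      by (intro nn_integral_cong) (auto simp: indicator_def)
    finally show ?thesis by (simp add: \<beta>_def)
  qed
  have "(\<integral>\<^sup>+z. indicator {z \<in> ball 0 1. ?P z \<in> UNIV} z * slab_integral N z
        \<partial>lborel) < \<infinity>"
    using fin by (simp only: UNIV_I simp_thms Collect_mem_eq)
  then have \<beta>fin: "emeasure \<beta> (space \<beta>) \<noteq> \<infinity>"
    by (subst \<open>space \<beta> = UNIV\<close>, subst \<beta>) (auto simp: ennreal_mult_eq_top_iff)
  have open_le: "emeasure \<alpha> V \<le> emeasure \<beta> V" if "open V" for V
    using emeasure_open_cone_le[OF N sets C null that] that by (simp add: \<alpha> \<beta>)
  have "emeasure \<alpha> A \<le> emeasure \<beta> A" if A: "A \<in> sets borel" for A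
  proof -
    have "emeasure \<alpha> A \<le> emeasure \<beta> V" if "A \<subseteq> V" "open V" for V
    proof -
      have "emeasure \<alpha> A \<le> emeasure \<alpha> V" using that by (intro emeasure_mono) auto
      then show ?thesis using open_le[OF \<open>open V\<close>] by (rule order_trans)
    qed
    then have "emeasure \<alpha> A \<le> (INF V\<in>{V. A \<subseteq> V \<and> open V}. emeasure \<beta> V)"
      by (intro INF_greatest) auto
    then show ?thesis by (subst outer_regular[OF _ \<beta>fin A]) simp_all
  qed
  then have "\<alpha> \<le> \<beta>" by (simp add: le_measure)
  then have "nn_integral \<alpha> h \<le> nn_integral \<beta> h"
    by (intro nn_integral_mono_measure) simp_all
  also have "nn_integral \<alpha> h = (\<integral>\<^sup>+w. h (?P w) \<partial>N)"
    unfolding \<alpha>_def by (rule nn_integral_distr) measurable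
  also have "nn_integral \<beta> h = ?K * (\<integral>\<^sup>+z. indicator (ball 0 1) z * slab_integral N z
        * h (?P z) \<partial>lborel)"
    unfolding \<beta>_def by (subst nn_integral_scale_measure) (simp_all add: nn_integral_distr nn_integral_density)
  finally show ?thesis by (simp add: mult_ac)
qed

section \<open>Mass of a slab in the unit ball\<close>

text \<open>
  The slab weight is the transform of a Gaussian on the line. Exchanging that integral
  with the Gaussian integral over \<open>z\<close> leaves a one-dimensional integral in which \<open>\<xi>\<close> enters by its
  norm only.
\<close>

lemma gaussian_slab_mass_eq:
  fixes \<xi> :: "'a::euclidean_space"
  shows "(\<integral>\<^sup>+z. ennreal (exp (- (norm z)\<^sup>2 / 2) * slab_weight z \<xi>) \<partial>lborel) =
    ennreal (sqrt (2 * pi) ^ DIM('a) / sqrt (2 * pi)) *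
    (\<integral>\<^sup>+t. ennreal (exp (- t\<^sup>2 / 2) * exp (- (2 * pi * norm \<xi> * t)\<^sup>2 / 2)) \<partial>lborel)"
proof -
  let ?k = "\<lambda>(t::real) z. complex_of_real (exp (- t\<^sup>2 / 2)) *
     (complex_of_real (exp (- (norm z)\<^sup>2 / 2)) * exp (\<i> * complex_of_real (z \<bullet> ((2 * pi * t) *\<^sub>R \<xi>))))"
  have ti: "integrable lborel (\<lambda>x::'b::euclidean_space. exp (- (norm x)\<^sup>2 / 2))"
    using integrable_gaussian_weight[of 1, where 'a='b] by simp
  have ti1: "integrable lborel (\<lambda>t::real. exp (- t\<^sup>2 / 2))"
    using integrable_gaussian_weight[of 1, where 'a=real] by simp
  have int: "integrable (lborel \<Otimes>\<^sub>M lborel) (case_prod ?k)"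
    by (rule integrable_product_bounded[OF _ _ ti1 integrable_gaussian_weight[of 1]])
      (auto simp: sigma_finite_lborel norm_mult)
  have inner_t: "(LINT z|lborel. ?k t z) =
      complex_of_real (sqrt (2 * pi) ^ DIM('a) * (exp (- t\<^sup>2 / 2) * exp (- (2 * pi * norm \<xi> * t)\<^sup>2 / 2)))" for t
    using has_bochner_integral_gaussian_fourier[of "(2 * pi * t) *\<^sub>R \<xi>"]
    by (simp add: has_bochner_integral_iff power_mult_distrib mult_ac)
  have inner_z: "(LINT t|lborel. ?k t z) = complex_of_real (sqrt (2 * pi) * (exp (- (norm z)\<^sup>2 / 2)
        * slab_weight z \<xi>))" for z
  proof -
    have "(LINT t|lborel. ?k t z) = (LINT t|lborel. complex_of_real (exp (- (norm z)\<^sup>2 / 2)) *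
       (complex_of_real (exp (- t\<^sup>2 / 2)) * exp (\<i> * complex_of_real (t * (2 * pi * (z \<bullet> \<xi>))))))"
      by (intro Bochner_Integration.integral_cong refl) (simp add: mult_ac)
    also have "\<dots> = complex_of_real (exp (- (norm z)\<^sup>2 / 2)) * complex_of_real (sqrt (2 * pi) * slab_weight z \<xi>)"
      using has_bochner_integral_gaussian_fourier_real[of "2 * pi * (z \<bullet> \<xi>)"]
      by (simp add: has_bochner_integral_iff slab_weight_def)
    finally show ?thesis by (simp add: mult_ac)
  qed
  let ?A = "\<lambda>t. exp (- t\<^sup>2 / 2) * exp (- (2 * pi * norm \<xi> * t)\<^sup>2 / 2)"
  let ?B = "\<lambda>z. exp (- (norm z)\<^sup>2 / 2) * slab_weight z \<xi>"
  have Ai: "integrable lborel ?A"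
    by (rule Bochner_Integration.integrable_bound[OF ti1]) auto
  have Bi: "integrable lborel ?B"
    by (rule Bochner_Integration.integrable_bound[OF ti])
      (auto simp: abs_mult abs_of_pos slab_weight_pos slab_weight_le_1 mult_left_le)
  have "complex_of_real (sqrt (2 * pi) ^ DIM('a) * (LINT t|lborel. ?A t))
        = complex_of_real (sqrt (2 * pi) * (LINT z|lborel. ?B z))"
    using lborel_pair.Fubini_integral[OF int] unfolding inner_t inner_z integral_complex_of_real by simp
  then have 1: "(LINT z|lborel. ?B z) = sqrt (2 * pi) ^ DIM('a) / sqrt (2 * pi) * (LINT t|lborel. ?A t)"
    unfolding of_real_eq_iff by (simp add: field_simps)
  have 2: "(\<integral>\<^sup>+z. ennreal (?B z) \<partial>lborel) = ennreal (LINT z|lborel. ?B z)"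
    by (intro nn_integral_eq_integral Bi) (simp add: slab_weight_pos less_imp_le)
  have 3: "(\<integral>\<^sup>+t. ennreal (?A t) \<partial>lborel) = ennreal (LINT t|lborel. ?A t)"
    by (intro nn_integral_eq_integral Ai) simp
  show ?thesis unfolding 1 2 3 by (rule ennreal_mult') simp
qed

text \<open>
  On the unit ball the indicator is at most \<open>exp (1/2) * exp (- |z|\<^sup>2 / 2)\<close>, so the Gaussian mass is
  an upper bound.
\<close>

lemma ball_slab_mass_le:
  fixes \<xi> :: "'a::euclidean_space"
  shows "(\<integral>\<^sup>+z. indicator (ball 0 1) z * ennreal (slab_weight z \<xi>) \<partial>lborel) \<le>
    ennreal (exp (1/2) * sqrt (2 * pi) ^ DIM('a) / max 1 (norm \<xi>))"
proof -
  let ?B = "\<lambda>z. exp (- (norm z)\<^sup>2 / 2) * slab_weight z \<xi>"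
  let ?c = "sqrt (2 * pi) ^ DIM('a)"
  have gauss: "(\<integral>\<^sup>+t. ennreal (exp (- (r * t)\<^sup>2 / 2)) \<partial>lborel)
        = ennreal (sqrt (2 * pi) / r)" if r: "r > 0" for r
  proof -
    have h: "has_bochner_integral lborel (\<lambda>t. complex_of_real (exp (- (r
          * t)\<^sup>2 / 2))) (complex_of_real (sqrt (2 * pi) / r))"
      using has_bochner_integral_scaled_gaussian_fourier[OF r, of "0::real"] by (simp add: power_mult_distrib)
    then have "integrable lborel (\<lambda>t. exp (- (r * t)\<^sup>2 / 2))" "(LINT t|lborel. exp (- (r
          * t)\<^sup>2 / 2)) = sqrt (2 * pi) / r"
      unfolding has_bochner_integral_iff complex_of_real_integrable_eq integral_complex_of_real of_real_eq_iff by blast+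
    then show ?thesis by (simp add: nn_integral_eq_integral)
  qed
  (* One of the two Gaussian factors is dropped: the second for small \<xi>, the first for large \<xi>. *)
  have le: "(\<integral>\<^sup>+t. ennreal (exp (- t\<^sup>2 / 2) * exp (- (2 * pi * norm \<xi> * t)\<^sup>2 / 2))
        \<partial>lborel) \<le> ennreal (sqrt (2 * pi) / max 1 (norm \<xi>))"
  proof (cases "norm \<xi> \<le> 1")
    case True
    have "(\<integral>\<^sup>+t. ennreal (exp (- t\<^sup>2 / 2) * exp (- (2 * pi * norm \<xi> * t)\<^sup>2 / 2))
          \<partial>lborel) \<le> (\<integral>\<^sup>+t. ennreal (exp (- (1 * t)\<^sup>2 / 2)) \<partial>lborel)"
      by (intro nn_integral_mono ennreal_leI) simp
    then show ?thesis using gauss[of 1] True by (simp add: max_absorb1)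
  next
    case False
    have "(\<integral>\<^sup>+t. ennreal (exp (- t\<^sup>2 / 2) * exp (- (2 * pi * norm \<xi> * t)\<^sup>2 / 2))
          \<partial>lborel) \<le> (\<integral>\<^sup>+t. ennreal (exp (- (norm \<xi> * t)\<^sup>2 / 2)) \<partial>lborel)"
    proof (intro nn_integral_mono ennreal_leI)
      fix t :: real
      have "1 \<le> 2 * pi" using pi_gt3 by linarith
      then have "(norm \<xi> * \<bar>t\<bar>)\<^sup>2 \<le> (2 * pi * (norm \<xi> * \<bar>t\<bar>))\<^sup>2"
        using mult_right_mono[of 1 "2 * pi" "norm \<xi> * \<bar>t\<bar>"] by (intro power_mono) auto
      then have "(norm \<xi> * t)\<^sup>2 \<le> (2 * pi * norm \<xi> * t)\<^sup>2"
        by (simp add: power_mult_distrib)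
      then have "exp (- (2 * pi * norm \<xi> * t)\<^sup>2 / 2) \<le> exp (- (norm \<xi> * t)\<^sup>2 / 2)" by simp
      then show "exp (- t\<^sup>2 / 2) * exp (- (2 * pi * norm \<xi> * t)\<^sup>2 / 2) \<le> exp (- (norm \<xi> * t)\<^sup>2 / 2)"
        by (meson exp_ge_zero exp_le_one_iff mult_left_le_one_le order_trans divide_nonpos_pos neg_le_0_iff_le zero_le_power2 zero_less_numeral)
    qed
    also have "\<dots> = ennreal (sqrt (2 * pi) / max 1 (norm \<xi>))"
      using False by (subst gauss) (auto simp: max_def)
    finally show ?thesis .
  qed
  have "(\<integral>\<^sup>+z. indicator (ball 0 1) z * ennreal (slab_weight z \<xi>) \<partial>lborel)
        \<le> (\<integral>\<^sup>+z. ennreal (exp (1/2)) * ennreal (?B z) \<partial>lborel)"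
  proof (intro nn_integral_mono)
    fix z :: 'a
    show "indicator (ball 0 1) z * ennreal (slab_weight z \<xi>) \<le> ennreal (exp (1/2)) * ennreal (?B z)"
    proof (cases "z \<in> ball 0 1")
      case True
      then have "(norm z)\<^sup>2 \<le> 1" by (simp add: power_le_one)
      then have "1 \<le> exp (1/2) * exp (- (norm z)\<^sup>2 / 2)" by (simp flip: exp_add)
      then have "1 * slab_weight z \<xi> \<le> exp (1/2) * exp (- (norm z)\<^sup>2 / 2) * slab_weight z \<xi>"
        by (rule mult_right_mono) (simp add: slab_weight_pos less_imp_le)
      then show ?thesis using True by (simp add: ennreal_mult'[symmetric] mult.assoc ennreal_leI)
    qed simp
  qed
  also have "\<dots> = ennreal (exp (1/2)) * (\<integral>\<^sup>+z. ennreal (?B z) \<partial>lborel)"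
    unfolding slab_weight_def by (rule nn_integral_cmult) measurable
  also have "\<dots> \<le> ennreal (exp (1/2)) * (ennreal (?c / sqrt (2 * pi)) * ennreal (sqrt (2 * pi) / max 1 (norm \<xi>)))"
    unfolding gaussian_slab_mass_eq by (intro mult_left_mono le) simp_all
  also have "\<dots> = ennreal (exp (1/2) * ?c / max 1 (norm \<xi>))"
    by (simp add: ennreal_mult[symmetric])
  finally show ?thesis .
qed

section \<open>Weighted integrability of the Fourier transform\<close>

text \<open>
  Cover the ball by unit cubes at lattice points and translate them all to the unit cube. The radius
  grows by \<open>n\<close>, which bounds the norm of a vector in the unit cube.
\<close>

lemma cball_fourier_integral_le:
  fixes M :: "(real^'n) measure"
  assumes M: "prob_space M" "sets M = sets borel" and R: "R \<ge> 1"
  shows "(\<integral>\<^sup>+\<xi>. indicator (cball 0 R) \<xi> * ennreal (cmod (fourier_transform M \<xi>))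
        \<partial>lborel) \<le>
    ennreal (SUP \<theta>\<in>cbox 0 1. \<Sum>\<xi>\<in>lattice_ball (R + real CARD('n)). cmod (fourier_transform M (\<xi> + \<theta>)))"
    (is "_ \<le> ennreal ?S")
proof -
  interpret prob_space M by fact
  note [measurable] = borel_measurable_fourier_transform[OF finite_measure_axioms M(2)]
  let ?F = "\<lambda>\<xi>. cmod (fourier_transform M \<xi>)"
  let ?L = "lattice_ball (R + real CARD('n)) :: (real^'n) set"
  have [measurable]: "cbox 0 (1::real^'n) \<in> sets borel" by simp
  have cover: "\<exists>k\<in>?L. \<xi> - k \<in> cbox 0 1" if "norm \<xi> \<le> R" for \<xi> :: "real^'n"
  proof
    let ?k = "\<chi> i. of_int \<lfloor>\<xi> $ i\<rfloor> :: real^'n"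
    have fr: "0 \<le> (\<xi> - ?k) $ i" "(\<xi> - ?k) $ i \<le> 1" for i
      by simp_all linarith
    show "\<xi> - ?k \<in> cbox 0 1" using fr by (simp add: mem_box_cart)
    have "norm (\<xi> - ?k) \<le> (\<Sum>i\<in>UNIV. \<bar>(\<xi> - ?k) $ i\<bar>)" by (rule norm_le_l1_cart)
    also have "\<dots> \<le> (\<Sum>i\<in>(UNIV::'n set). 1)" using fr by (intro sum_mono) (simp add: abs_le_iff)
    finally have "norm (\<xi> - ?k) \<le> real CARD('n)" by simp
    then have "norm ?k \<le> R + real CARD('n)"
      using that norm_triangle_ineq4[of \<xi> "\<xi> - ?k"] by simp
    then show "?k \<in> ?L" by (simp add: lattice_ball_def)
  qed
  have "(\<integral>\<^sup>+\<xi>. indicator (cball 0 R) \<xi> * ennreal (?F \<xi>) \<partial>lborel) \<le>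
    (\<integral>\<^sup>+\<xi>. (\<Sum>k\<in>?L. indicator (cbox 0 1) (\<xi> - k) * ennreal (?F \<xi>)) \<partial>lborel)"
  proof (rule nn_integral_mono)
    fix \<xi> :: "real^'n"
    show "indicator (cball 0 R) \<xi> * ennreal (?F \<xi>)
          \<le> (\<Sum>k\<in>?L. indicator (cbox 0 1) (\<xi> - k) * ennreal (?F \<xi>))"
    proof (cases "norm \<xi> \<le> R")
      case True
      then obtain k where k: "k \<in> ?L" "\<xi> - k \<in> cbox 0 1" using cover by blast
      have "indicator (cball 0 R) \<xi> * ennreal (?F \<xi>) \<le> indicator (cbox 0 1) (\<xi> - k) * ennreal (?F \<xi>)"
        using k True by simp
      also have "\<dots> \<le> (\<Sum>k\<in>?L. indicator (cbox 0 1) (\<xi> - k) * ennreal (?F \<xi>))"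
        by (rule member_le_sum[OF k(1)]) (simp_all add: finite_lattice_ball)
      finally show ?thesis .
    qed simp
  qed
  also have "\<dots> = (\<Sum>k\<in>?L. \<integral>\<^sup>+\<xi>. indicator (cbox 0 1) (\<xi> - k)
        * ennreal (?F \<xi>) \<partial>lborel)"
    by (rule nn_integral_sum) measurable
  also have "\<dots> = (\<Sum>k\<in>?L. \<integral>\<^sup>+\<theta>. indicator (cbox 0 1) \<theta> * ennreal (?F (k
        + \<theta>)) \<partial>lborel)"
  proof (rule sum.cong[OF refl])
    fix k :: "real^'n"
    have "(\<lambda>\<xi>. indicator (cbox 0 1) (\<xi> - k) * ennreal (?F \<xi>)) \<in> borel_measurable borel" by measurable
    from nn_integral_lborel_affine[OF this, of 1 k]
    show "(\<integral>\<^sup>+\<xi>. indicator (cbox 0 1) (\<xi> - k) * ennreal (?F \<xi>) \<partial>lborel) =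
      (\<integral>\<^sup>+\<theta>. indicator (cbox 0 1) \<theta> * ennreal (?F (k + \<theta>)) \<partial>lborel)" by simp
  qed
  also have "\<dots> = (\<integral>\<^sup>+\<theta>. (\<Sum>k\<in>?L. indicator (cbox 0 1) \<theta>
        * ennreal (?F (k + \<theta>))) \<partial>lborel)"
    by (rule nn_integral_sum[symmetric]) measurable
  also have "\<dots> \<le> (\<integral>\<^sup>+\<theta>. ennreal ?S * indicator (cbox 0 1) (\<theta>::real^'n) \<partial>lborel)"
  proof (rule nn_integral_mono)
    fix \<theta> :: "real^'n"
    show "(\<Sum>k\<in>?L. indicator (cbox 0 1) \<theta> * ennreal (?F (k + \<theta>)))
          \<le> ennreal ?S * indicator (cbox 0 1) \<theta>"
    proof (cases "\<theta> \<in> cbox 0 1")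
      case True
      have "(\<Sum>k\<in>?L. ?F (k + \<theta>)) \<le> ?S"
        by (rule cSUP_upper[OF True bdd_above_fourier_sums[OF M(1)]])
      then show ?thesis using True by (simp add: sum_nonneg ennreal_leI)
    qed simp
  qed
  also have "\<dots> = ennreal ?S * emeasure lborel (cbox 0 (1::real^'n))"
    by (rule nn_integral_cmult_indicator) simp
  also have "emeasure lborel (cbox 0 (1::real^'n)) = 1"
  proof -
    have "(1::real^'n) \<bullet> b = 1" if "b \<in> Basis" for b
      using that by (auto simp: Basis_vec_def inner_axis)
    then show ?thesis by (simp add: emeasure_lborel_cbox)
  qed
  finally show ?thesis by simp
qed

text \<open>
  If \<open>s\<close> is an admissible exponent above \<open>n - b\<close>, then the integral over the ball of radius \<open>2\<^sup>j\<close> is at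
  most a constant times \<open>2 powr (j * a)\<close> with \<open>a < b\<close>, while the weight is about \<open>2 powr (- j * b)\<close>
  where it first matters. The dyadic sum is a convergent geometric series.
\<close>

lemma fourier_weighted_integral_finite:
  fixes M :: "(real^'n) measure"
  assumes M: "prob_space M" "sets M = sets borel" and b: "b > 0"
    and dim: "l1_dim M > ennreal (real CARD('n) - b)"
  shows "(\<integral>\<^sup>+\<xi>. ennreal (cmod (fourier_transform M \<xi>) * max 1 (norm \<xi>) powr (- b))
        \<partial>lborel) < \<infinity>"
proof -
  interpret prob_space M by fact
  note [measurable] = borel_measurable_fourier_transform[OF finite_measure_axioms M(2)]
  have [measurable]: "cball (0::real^'n) r \<in> sets borel" for r by simp
  let ?F = "\<lambda>\<xi>. cmod (fourier_transform M \<xi>)"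
  let ?n = "real CARD('n)"
  obtain s C where s: "s > 0" "ennreal (?n - b) < ennreal s"
    and C: "\<And>R. R \<ge> 1
          \<Longrightarrow> (SUP \<theta>\<in>cbox 0 1. \<Sum>\<xi>\<in>lattice_ball R. ?F (\<xi> + \<theta>))
          \<le> C * R powr (?n - s)"
    using dim unfolding l1_dim_def less_Sup_iff by blast
  have sb: "?n - s < b"
    using s(2) ennreal_leI[of s "?n - b"] by (cases "s \<le> ?n - b") (auto simp: leD)
  (* An exponent of R that is nonnegative makes the bound monotone in R, so that R + n can be absorbed. *)
  define a where "a = max 0 (?n - s)"
  have a: "a \<ge> 0" "a < b" "?n - s \<le> a" using sb b by (auto simp: a_def)
  define C' where "C' = \<bar>C\<bar> * (1 + ?n) powr a"
  have ball: "(\<integral>\<^sup>+\<xi>. indicator (cball 0 R) \<xi> * ennreal (?F \<xi>) \<partial>lborel)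
        \<le> ennreal (C' * R powr a)" if R: "R \<ge> 1" for R
  proof -
    have R1: "R + ?n \<ge> 1" using R by simp
    have "R + ?n \<le> (1 + ?n) * R" using R by (simp add: distrib_right mult_le_cancel_left1)
    have "(SUP \<theta>\<in>cbox 0 1. \<Sum>\<xi>\<in>lattice_ball (R + ?n). ?F (\<xi> + \<theta>))
          \<le> C * (R + ?n) powr (?n - s)"
      by (rule C[OF R1])
    also have "\<dots> \<le> \<bar>C\<bar> * (R + ?n) powr a"
      using R1 a by (intro mult_mono powr_mono) auto
    also have "\<dots> \<le> \<bar>C\<bar> * ((1 + ?n) * R) powr a"
      using R1 a \<open>R + ?n \<le> (1 + ?n) * R\<close> by (intro mult_left_mono powr_mono2) auto
    also have "\<dots> = C' * R powr a" using R by (simp add: C'_def powr_mult)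
    finally show ?thesis
      by (intro order_trans[OF cball_fourier_integral_le[OF M R]] ennreal_leI)
  qed
  (* The factor 2 powr b corrects the weight by one dyadic step: |\<xi>| is only known to exceed 2 ^ (j - 1). *)
  define c where "c j = 2 powr b * (2 ^ j) powr (- b)" for j :: nat
  have weight_le: "ennreal (max 1 (norm \<xi>) powr (- b))
        \<le> (\<Sum>j. ennreal (c j) * indicator (cball 0 (2 ^ j)) \<xi>)" for \<xi> :: "real^'n"
  proof -
    obtain j0 where "norm \<xi> < 2 ^ j0" using real_arch_pow[of 2 "norm \<xi>"] by auto
    then have ex: "norm \<xi> \<le> 2 ^ j0" by simp
    define j where "j = (LEAST j. norm \<xi> \<le> 2 ^ j)"
    have j: "norm \<xi> \<le> 2 ^ j" unfolding j_def by (rule LeastI[of "\<lambda>j. norm \<xi> \<le> 2 ^ j", OF ex])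
    have "max 1 (norm \<xi>) powr (- b) \<le> c j"
    proof (cases j)
      case 0
      then show ?thesis using j b by (simp add: c_def ge_one_powr_ge_zero)
    next
      case (Suc i)
      have "\<not> norm \<xi> \<le> 2 ^ i"
        using not_less_Least[of i "\<lambda>j. norm \<xi> \<le> 2 ^ j"] Suc by (simp add: j_def)
      then have "max 1 (norm \<xi>) powr (- b) \<le> (2 ^ i) powr (- b)"
        using b by (intro powr_mono2') auto
      also have "\<dots> = c j"
        by (simp add: c_def Suc powr_mult powr_minus)
      finally show ?thesis .
    qed
    then have "ennreal (max 1 (norm \<xi>) powr (- b)) \<le> ennreal (c j) * indicator (cball 0 (2 ^ j)) \<xi>"
      using j by (simp add: ennreal_leI)
    also have "\<dots> \<le> (\<Sum>j. ennreal (c j) * indicator (cball 0 (2 ^ j)) \<xi>)"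
      (is "?f j \<le> suminf ?f")
    proof -
      have "sum ?f {j} \<le> suminf ?f" by (intro sum_le_suminf) simp_all
      then show ?thesis by (simp only: sum.insert finite.emptyI empty_iff not_False_eq_True sum.empty add_0_right)
    qed
    finally show ?thesis .
  qed
  have "(\<integral>\<^sup>+\<xi>. ennreal (?F \<xi> * max 1 (norm \<xi>) powr (- b)) \<partial>lborel) \<le>
    (\<integral>\<^sup>+\<xi>. (\<Sum>j. ennreal (c j) * (indicator (cball 0 (2 ^ j)) \<xi> * ennreal (?F \<xi>))) \<partial>lborel)"
  proof (rule nn_integral_mono)
    fix \<xi> :: "real^'n"
    have "ennreal (?F \<xi> * max 1 (norm \<xi>) powr (- b))
          \<le> (\<Sum>j. ennreal (c j) * indicator (cball 0 (2 ^ j)) \<xi>) * ennreal (?F \<xi>)"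
      using mult_right_mono[OF weight_le, of "ennreal (?F \<xi>)"] by (simp add: ennreal_mult mult.commute)
    then show "ennreal (?F \<xi> * max 1 (norm \<xi>) powr (- b))
          \<le> (\<Sum>j. ennreal (c j) * (indicator (cball 0 (2 ^ j)) \<xi> * ennreal (?F \<xi>)))"
      by (simp add: ennreal_suminf_multc[symmetric] mult.assoc)
  qed
  also have "\<dots> = (\<Sum>j. \<integral>\<^sup>+\<xi>. ennreal (c j) * (indicator (cball 0 (2 ^ j)) \<xi>
        * ennreal (?F \<xi>)) \<partial>lborel)"
    by (rule nn_integral_suminf) measurable
  also have "\<dots> = (\<Sum>j. ennreal (c j) * (\<integral>\<^sup>+\<xi>. indicator (cball 0 (2 ^ j)) \<xi>
        * ennreal (?F \<xi>) \<partial>lborel))"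
    by (intro suminf_cong nn_integral_cmult) measurable
  also have "\<dots> \<le> (\<Sum>j. ennreal (2 powr b * C' * (2 powr (a - b)) ^ j))"
  proof (rule suminf_le)
    fix j :: nat
    have "ennreal (c j) * (\<integral>\<^sup>+\<xi>. indicator (cball 0 (2 ^ j)) \<xi> * ennreal (?F \<xi>)
          \<partial>lborel) \<le> ennreal (c j) * ennreal (C' * (2 ^ j) powr a)"
      by (intro mult_left_mono ball) simp_all
    also have "\<dots> = ennreal (2 powr b * C' * ((2 ^ j) powr (- b) * (2 ^ j) powr a))"
      by (simp add: c_def C'_def ennreal_mult[symmetric] mult_ac)
    also have "(2 ^ j) powr (- b) * (2 ^ j) powr a = (2 powr (a - b)) ^ j"
      by (simp add: powr_add[symmetric] powr_power[symmetric] powr_realpow[symmetric] powr_powr algebra_simps)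
    finally show "ennreal (c j) * (\<integral>\<^sup>+\<xi>. indicator (cball 0 (2 ^ j)) \<xi> * ennreal (?F \<xi>)
          \<partial>lborel) \<le> ennreal (2 powr b * C' * (2 powr (a - b)) ^ j)" .
  qed simp_all
  also have "\<dots> < \<infinity>"
  proof -
    have "2 powr (a - b) < (1::real)" using a by (simp add: powr_less_one)
    then have "summable (\<lambda>j. 2 powr b * C' * (2 powr (a - b)) ^ j)"
      by (intro summable_mult summable_geometric) simp
    then show ?thesis
      by (simp add: suminf_ennreal2 C'_def)
  qed
  finally show ?thesis .
qed

section \<open>Estimates for the dominating function\<close>

text \<open>
  A crude form of Young's inequality: the first term on the right suffices if \<open>b \<le> \<eta> * a\<close>, and the
  second one otherwise.
\<close>

lemma power_mult_le_Young:
  fixes a b \<eta> :: real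
  assumes "a \<ge> 0" "b \<ge> 0" "\<eta> > 0" "p \<ge> 1"
  shows "a ^ (p - 1) * b \<le> \<eta> * a ^ p + b ^ p / \<eta> ^ (p - 1)"
proof (cases "b \<le> \<eta> * a")
  case True
  have "a ^ (p - 1) * b \<le> a ^ (p - 1) * (\<eta> * a)"
    using True assms by (intro mult_left_mono) auto
  also have "\<dots> = \<eta> * a ^ p" using \<open>p \<ge> 1\<close> by (cases p) auto
  also have "\<dots> \<le> \<eta> * a ^ p + b ^ p / \<eta> ^ (p - 1)" using assms by simp
  finally show ?thesis .
next
  case False
  then have "a \<le> b / \<eta>" using assms by (simp add: field_simps)
  then have "a ^ (p - 1) * b \<le> (b / \<eta>) ^ (p - 1) * b"
    using assms by (intro mult_right_mono power_mono) auto
  also have "\<dots> = b ^ p / \<eta> ^ (p - 1)" using \<open>p \<ge> 1\<close> by (cases p) (auto simp: power_divide)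
  also have "\<dots> \<le> \<eta> * a ^ p + b ^ p / \<eta> ^ (p - 1)" using assms by simp
  finally show ?thesis .
qed

lemma ball_integral_slab_integral_eq:
  fixes N :: "(real^'n) measure"
  assumes N: "finite_measure N" and sets: "sets N = sets borel"
    and u [measurable]: "u \<in> borel_measurable borel"
  shows "(\<integral>\<^sup>+z. indicator (ball 0 1) z * (u z * slab_integral N z) \<partial>lborel) =
    (\<integral>\<^sup>+\<xi>. ennreal (cmod (fourier_transform N \<xi>)) *
       (\<integral>\<^sup>+z. indicator (ball 0 1) z * (u z * ennreal (slab_weight z \<xi>)) \<partial>lborel) \<partial>lborel)"
proof -
  note [measurable] = borel_measurable_fourier_transform[OF N sets]
  have [measurable]: "ball (0::real^'n) 1 \<in> sets borel" by simp
  have "(\<integral>\<^sup>+z. indicator (ball 0 1) z * (u z * slab_integral N z) \<partial>lborel) =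
    (\<integral>\<^sup>+z. \<integral>\<^sup>+\<xi>. ennreal (cmod (fourier_transform N \<xi>)) *
       (indicator (ball 0 1) z * (u z * ennreal (slab_weight z \<xi>))) \<partial>lborel \<partial>lborel)"
    unfolding slab_integral_def
    by (simp add: nn_integral_cmult[symmetric] ennreal_mult less_imp_le slab_weight_pos mult_ac)
  also have "\<dots> = (\<integral>\<^sup>+\<xi>. \<integral>\<^sup>+z. ennreal (cmod (fourier_transform N \<xi>)) *
       (indicator (ball 0 1) z * (u z * ennreal (slab_weight z \<xi>))) \<partial>lborel \<partial>lborel)"
    by (rule lborel_pair.Fubini') measurable
  also have "\<dots> = (\<integral>\<^sup>+\<xi>. ennreal (cmod (fourier_transform N \<xi>)) *
       (\<integral>\<^sup>+z. indicator (ball 0 1) z * (u z * ennreal (slab_weight z \<xi>)) \<partial>lborel) \<partial>lborel)"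
    by (intro nn_integral_cong nn_integral_cmult) measurable
  finally show ?thesis .
qed

text \<open>
  Young's inequality is applied for each \<open>\<xi>\<close> separately with parameter \<open>\<eta> w\<close>, where
  \<open>w = (max 1 |\<xi>|) powr (- 1/p)\<close>. As the \<open>p\<close>-th power of the slab weight has mass at most \<open>c * w\<^sup>p\<close>, both
  resulting terms are proportional to \<open>w\<close>, and the remaining integral over \<open>\<xi>\<close> is the
  weighted integral of the transform. With \<open>u = 1\<close> this shows that the slab integral is integrable on the ball;
  with truncated densities and small \<open>\<eta>\<close> the first term can be absorbed.
\<close>

lemma ball_integral_slab_integral_le:
  fixes N :: "(real^'n) measure"
  assumes N: "finite_measure N" and sets: "sets N = sets borel"
    and u [measurable]: "u \<in> borel_measurable borel" and u0: "\<And>z. u z \<ge> 0"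
    and p: "p \<ge> 1" and \<eta>: "\<eta> > 0"
  shows "(\<integral>\<^sup>+z. indicator (ball 0 1) z * (ennreal (u z ^ (p - 1)) * slab_integral N z) \<partial>lborel) \<le>
    (\<integral>\<^sup>+\<xi>. ennreal (cmod (fourier_transform N \<xi>) * max 1 (norm \<xi>) powr (- (1 / real p))) \<partial>lborel) *
    (ennreal \<eta> * (\<integral>\<^sup>+z. indicator (ball 0 1) z * ennreal (u z ^ p) \<partial>lborel) +
       ennreal (exp (1/2) * sqrt (2 * pi) ^ CARD('n) / \<eta> ^ (p - 1)))"
    (is "?lhs \<le> ?I * (ennreal \<eta> * ?U + ennreal (?c / _))")
proof -
  note [measurable] = borel_measurable_fourier_transform[OF N sets]
  have [measurable]: "ball (0::real^'n) 1 \<in> sets borel" by simp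
  let ?w = "\<lambda>\<xi>::real^'n. max 1 (norm \<xi>) powr (- (1 / real p))"
  have c0: "?c \<ge> 0" by simp
  have inner: "(\<integral>\<^sup>+z. indicator (ball 0 1) z * (ennreal (u z ^ (p - 1))
        * ennreal (slab_weight z \<xi>)) \<partial>lborel)
    \<le> ennreal (?w \<xi>) * (ennreal \<eta> * ?U + ennreal (?c / \<eta> ^ (p - 1)))" for \<xi> :: "real^'n"
  proof -
    have w: "?w \<xi> > 0" by (auto simp: max_def)
    have wp: "?w \<xi> ^ p = 1 / max 1 (norm \<xi>)"
    proof -
      have "?w \<xi> ^ p = max 1 (norm \<xi>) powr (- (1 / real p) * real p)"
        using w by (simp only: powr_realpow[symmetric] powr_powr)
      also have "- (1 / real p) * real p = - 1" using p by simp
      finally show ?thesis by (simp add: powr_minus_divide max_def)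
    qed
    let ?e = "\<eta> * ?w \<xi>"
    have e: "?e > 0" using \<eta> w by (rule mult_pos_pos)
    have "(\<integral>\<^sup>+z. indicator (ball 0 1) z * (ennreal (u z ^ (p - 1)) * ennreal (slab_weight z \<xi>))
          \<partial>lborel) \<le>
      (\<integral>\<^sup>+z. ennreal ?e * (indicator (ball 0 1) z * ennreal (u z ^ p)) +
         ennreal (1 / ?e ^ (p - 1)) * (indicator (ball 0 1) z * ennreal (slab_weight z \<xi>)) \<partial>lborel)"
    proof (rule nn_integral_mono)
      fix z :: "real^'n"
      have s: "slab_weight z \<xi> \<ge> 0" by (simp add: slab_weight_pos less_imp_le)
      have "slab_weight z \<xi> ^ p \<le> slab_weight z \<xi> ^ 1"
        by (intro power_decreasing p s slab_weight_le_1)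
      have "u z ^ (p - 1) * slab_weight z \<xi> \<le> ?e * u z ^ p + slab_weight z \<xi> ^ p / ?e ^ (p - 1)"
        by (rule power_mult_le_Young[OF u0 s e p])
      also have "\<dots> \<le> ?e * u z ^ p + 1 / ?e ^ (p - 1) * slab_weight z \<xi>"
        using \<open>slab_weight z \<xi> ^ p \<le> slab_weight z \<xi> ^ 1\<close> e by (simp add: divide_right_mono)
      finally have "ennreal (u z ^ (p - 1) * slab_weight z \<xi>)
            \<le> ennreal (?e * u z ^ p + 1 / ?e ^ (p - 1) * slab_weight z \<xi>)"
        by (rule ennreal_leI)
      also have "\<dots> = ennreal ?e * ennreal (u z ^ p) + ennreal (1 / ?e ^ (p - 1)) * ennreal (slab_weight z \<xi>)"
        using e u0[of z] s by (simp add: ennreal_plus[symmetric] ennreal_mult[symmetric] del: ennreal_plus)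
      finally have "ennreal (u z ^ (p - 1)) * ennreal (slab_weight z \<xi>)
            \<le> ennreal ?e * ennreal (u z ^ p) + ennreal (1 / ?e ^ (p - 1)) * ennreal (slab_weight z \<xi>)"
        using u0[of z] by (simp only: ennreal_mult' zero_le_power)
      then show "indicator (ball 0 1) z * (ennreal (u z ^ (p - 1)) * ennreal (slab_weight z \<xi>)) \<le>
        ennreal ?e * (indicator (ball 0 1) z * ennreal (u z ^ p)) + ennreal (1 / ?e ^ (p - 1)) * (indicator (ball 0 1) z * ennreal (slab_weight z \<xi>))"
        by (cases "z \<in> ball 0 1") simp_all
    qed
    also have "\<dots> = ennreal ?e * ?U + ennreal (1 / ?e ^ (p - 1))
          * (\<integral>\<^sup>+z. indicator (ball 0 1) z * ennreal (slab_weight z \<xi>) \<partial>lborel)"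
      by (subst nn_integral_add) (simp_all add: nn_integral_cmult)
    also have "\<dots> \<le> ennreal ?e * ?U + ennreal (1 / ?e ^ (p - 1)) * ennreal (?c / max 1 (norm \<xi>))"
      using ball_slab_mass_le[of \<xi>] by (intro add_left_mono mult_left_mono) simp_all
    also have "ennreal (1 / ?e ^ (p - 1)) * ennreal (?c / max 1 (norm \<xi>)) = ennreal (?w \<xi> * (?c / \<eta> ^ (p - 1)))"
    proof -
      have "1 / ?e ^ (p - 1) * (?c / max 1 (norm \<xi>)) = 1 / ?e ^ (p - 1) * (?c * ?w \<xi> ^ p)"
        unfolding wp by simp
      also have "?w \<xi> ^ p = ?w \<xi> * ?w \<xi> ^ (p - 1)" using p by (cases p) auto
      also have "1 / ?e ^ (p - 1) * (?c * (?w \<xi> * ?w \<xi> ^ (p - 1))) = ?w \<xi> * (?c / \<eta> ^ (p - 1))"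
        unfolding power_mult_distrib using w \<eta> by (simp add: divide_simps)
      finally have "1 / ?e ^ (p - 1) * (?c / max 1 (norm \<xi>)) = ?w \<xi> * (?c / \<eta> ^ (p - 1))" .
      then show ?thesis using e by (subst ennreal_mult[symmetric]) simp_all
    qed
    also have "ennreal ?e * ?U + ennreal (?w \<xi> * (?c / \<eta> ^ (p - 1)))
          = ennreal (?w \<xi>) * (ennreal \<eta> * ?U + ennreal (?c / \<eta> ^ (p - 1)))"
      using \<eta> w c0 by (simp only: ennreal_mult less_imp_le distrib_left mult_ac divide_nonneg_pos zero_less_power)
    finally show ?thesis .
  qed
  have "?lhs = (\<integral>\<^sup>+\<xi>. ennreal (cmod (fourier_transform N \<xi>)) *
       (\<integral>\<^sup>+z. indicator (ball 0 1) z * (ennreal (u z ^ (p - 1)) * ennreal (slab_weight z \<xi>)) \<partial>lborel) \<partial>lborel)"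
    by (rule ball_integral_slab_integral_eq[OF N sets]) measurable
  also have "\<dots> \<le> (\<integral>\<^sup>+\<xi>. ennreal (cmod (fourier_transform N \<xi>))
        * (ennreal (?w \<xi>) * (ennreal \<eta> * ?U + ennreal (?c / \<eta> ^ (p - 1)))) \<partial>lborel)"
    by (intro nn_integral_mono mult_left_mono inner) simp
  also have "\<dots> = (\<integral>\<^sup>+\<xi>. ennreal (cmod (fourier_transform N \<xi>) * ?w \<xi>)
        * (ennreal \<eta> * ?U + ennreal (?c / \<eta> ^ (p - 1))) \<partial>lborel)"
    by (simp add: ennreal_mult mult_ac)
  also have "\<dots> = ?I * (ennreal \<eta> * ?U + ennreal (?c / \<eta> ^ (p - 1)))"
    by (rule nn_integral_multc) measurable
  finally show ?thesis .
qed

lemma measure_support_complement_null: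
  fixes M :: "'a::second_countable_topology measure"
  assumes sets: "sets M = sets borel"
  shows "- measure_support M \<in> null_sets M"
proof -
  let ?F = "{U. open U \<and> emeasure M U = 0}"
  obtain F' where F': "F' \<subseteq> ?F" "countable F'" "\<Union>F' = \<Union>?F"
    using Lindelof[of ?F] by auto
  have "(\<Union>U\<in>F'. U) \<in> null_sets M"
    using F'(1) by (intro null_sets_UN' F'(2)) (auto simp: null_sets_def sets)
  then have "\<Union>F' \<in> null_sets M" by simp
  moreover have "- measure_support M = \<Union>?F"
    by (auto simp: measure_support_def not_gr_zero)
  ultimately show ?thesis using F'(3) by simp
qed

lemma cmod_fourier_transform_translate:
  fixes M :: "(real^'n) measure"
  assumes "sets M = sets borel"
  shows "cmod (fourier_transform (distr M borel (\<lambda>w. w - x)) \<xi>) = cmod (fourier_transform M \<xi>)"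
proof -
  note [measurable_cong] = assms
  have m: "(\<lambda>w. w - x) \<in> M \<rightarrow>\<^sub>M borel" by measurable
  have "fourier_transform (distr M borel (\<lambda>w. w - x)) \<xi> =
    (LINT w|M. exp (- 2 * complex_of_real pi * \<i> * complex_of_real ((w - x) \<bullet> \<xi>)))"
    unfolding fourier_transform_def by (rule integral_distr[OF m]) measurable
  also have "\<dots> = (LINT w|M. exp (\<i> * complex_of_real (2 * pi * (x \<bullet> \<xi>))) * exp (- 2
        * complex_of_real pi * \<i> * complex_of_real (w \<bullet> \<xi>)))"
    by (intro Bochner_Integration.integral_cong refl) (simp add: exp_add[symmetric] inner_diff_left algebra_simps)
  also have "\<dots> = exp (\<i> * complex_of_real (2 * pi * (x \<bullet> \<xi>))) * fourier_transform M \<xi>"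
    by (simp add: fourier_transform_def)
  finally show ?thesis by (simp only: norm_mult norm_exp_i_of_real mult_1_left)
qed

lemma nn_integral_sphere_measure:
  fixes h :: "'a::euclidean_space \<Rightarrow> ennreal"
  assumes [measurable]: "h \<in> borel_measurable borel"
  shows "nn_integral sphere_measure h = of_nat DIM('a) * (\<integral>\<^sup>+z. indicator (ball 0 1) z
        * h (radial_proj 0 z) \<partial>lborel)"
proof -
  have [measurable]: "h \<in> borel_measurable sphere_borel" by (rule measurable_restrict_space1) measurable
  have pm: "radial_proj 0 \<in> restrict_space lborel (ball 0 1 - {0}) \<rightarrow>\<^sub>M (sphere_borel :: 'a measure)"
  proof (rule measurable_restrict_space2)
    show "radial_proj 0 \<in> space (restrict_space lborel (ball 0 1 - {0})) \<rightarrow> sphere 0 (1::real)"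
      by (auto simp: radial_proj_def space_restrict_space)
    show "(radial_proj 0 :: 'a \<Rightarrow> 'a) \<in> restrict_space lborel (ball 0 1 - {0}) \<rightarrow>\<^sub>M borel"
      by (rule measurable_restrict_space1) measurable
  qed
  have "nn_integral sphere_measure h = of_nat DIM('a) * (\<integral>\<^sup>+z. h (radial_proj 0 z)
        \<partial>restrict_space lborel (ball 0 1 - {0}))"
    unfolding sphere_measure_def by (subst nn_integral_scale_measure) (simp_all add: nn_integral_distr[OF pm])
  also have "(\<integral>\<^sup>+z. h (radial_proj 0 z) \<partial>restrict_space lborel (ball 0 1 - {0}))
        = (\<integral>\<^sup>+z. h (radial_proj 0 z) * indicator (ball 0 1 - {0}) z \<partial>lborel)"
    by (rule nn_integral_restrict_space) simp
  also have "\<dots> = (\<integral>\<^sup>+z. indicator (ball 0 1) z * h (radial_proj 0 z) \<partial>lborel)"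
  proof (rule nn_integral_cong_AE)
    show "AE z in lborel. h (radial_proj 0 z) * indicator (ball 0 1 - {0}) z = indicator (ball 0 1) z * h (radial_proj 0 z)"
      using AE_lborel_singleton[of "0::'a"] by eventually_elim (auto simp: indicator_def)
  qed
  finally show ?thesis .
qed

lemma nn_integral_radial_pushforward_le:
  fixes M :: "'a::euclidean_space measure"
  assumes sets: "sets M = sets borel" and [measurable]: "h \<in> borel_measurable borel"
  shows "nn_integral (radial_pushforward x M) h \<le> (\<integral>\<^sup>+w. h (radial_proj 0 w)
        \<partial>distr M borel (\<lambda>w. w - x))"
proof -
  note [measurable_cong] = sets
  have [measurable]: "h \<in> borel_measurable sphere_borel" by (rule measurable_restrict_space1) measurable
  have "nn_integral (radial_pushforward x M) h = (\<integral>\<^sup>+w. h (radial_proj x w) \<partial>restrict_space M (- {x}))"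
    unfolding radial_pushforward_def by (intro nn_integral_distr measurable_radial_proj sets) measurable
  also have "\<dots> = (\<integral>\<^sup>+w. h (radial_proj x w) * indicator (- {x}) w \<partial>M)"
    by (rule nn_integral_restrict_space) (simp add: sets)
  also have "\<dots> \<le> (\<integral>\<^sup>+w. h (radial_proj 0 (w - x)) \<partial>M)"
    by (intro nn_integral_mono) (auto simp: radial_proj_def indicator_def)
  also have "\<dots> = (\<integral>\<^sup>+w. h (radial_proj 0 w) \<partial>distr M borel (\<lambda>w. w - x))"
    by (rule nn_integral_distr[symmetric]) measurable
  finally show ?thesis .
qed

section \<open>Absolute continuity and p-th power integrability of the density\<close>

text \<open>
  The truncation at \<open>k\<close> makes the \<open>p\<close>-th moment finite, so that half of it can be subtracted from both sides.
  The resulting bound is uniform in \<open>k\<close> and survives the limit by Fatou's lemma.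
\<close>

lemma nn_integral_power_le_if_absorbing:
  fixes \<sigma> :: "'a measure" and g :: "'a \<Rightarrow> real"
  assumes fin: "emeasure \<sigma> (space \<sigma>) < \<infinity>" and g [measurable]: "g \<in> borel_measurable \<sigma>" and g0: "\<And>u. g u \<ge> 0"
    and p: "p \<ge> 1"
    and absorb: "\<And>k::nat. (\<integral>\<^sup>+u. ennreal (g u) * ennreal (min (g u) (real k) ^ (p - 1))
          \<partial>\<sigma>) \<le>
      ennreal (1/2) * (\<integral>\<^sup>+u. ennreal (min (g u) (real k) ^ p) \<partial>\<sigma>) + ennreal D"
    and D: "D \<ge> 0"
  shows "(\<integral>\<^sup>+u. ennreal (g u ^ p) \<partial>\<sigma>) \<le> ennreal (2 * D)"
proof -
  have trunc: "(\<integral>\<^sup>+u. ennreal (min (g u) (real k) ^ p) \<partial>\<sigma>)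
        \<le> ennreal (2 * D)" (is "?A \<le> _") for k :: nat
  proof -
    have "?A \<le> (\<integral>\<^sup>+u. ennreal (real k ^ p) \<partial>\<sigma>)"
      using g0 by (intro nn_integral_mono ennreal_leI power_mono) auto
    also have "\<dots> < \<infinity>" using fin by (simp add: ennreal_mult_less_top)
    finally obtain a where a: "?A = ennreal a" "a \<ge> 0"
      by (cases ?A) auto
    have "?A \<le> (\<integral>\<^sup>+u. ennreal (g u) * ennreal (min (g u) (real k) ^ (p - 1)) \<partial>\<sigma>)"
    proof (intro nn_integral_mono)
      fix u
      have "min (g u) (real k) ^ p = min (g u) (real k) * min (g u) (real k) ^ (p - 1)"
        using p by (cases p) auto
      also have "\<dots> \<le> g u * min (g u) (real k) ^ (p - 1)"
        using g0[of u] by (intro mult_right_mono) auto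
      finally show "ennreal (min (g u) (real k) ^ p) \<le> ennreal (g u) * ennreal (min (g u) (real k) ^ (p - 1))"
        using g0[of u] by (simp add: ennreal_mult'[symmetric] ennreal_leI)
    qed
    also have "\<dots> \<le> ennreal (1/2) * ?A + ennreal D" by (rule absorb)
    finally have "?A \<le> ennreal (1/2) * ?A + ennreal D" .
    have "ennreal a \<le> ennreal (1/2 * a + D)"
    proof -
      have "ennreal (1/2) * ennreal a + ennreal D = ennreal (1/2 * a + D)"
        using a(2) D by (subst ennreal_plus) (auto simp only: ennreal_mult zero_le_divide_1_iff zero_le_numeral mult_nonneg_nonneg)
      then show ?thesis using \<open>?A \<le> ennreal (1/2) * ?A + ennreal D\<close> by (simp only: a(1))
    qed
    then have "a \<le> 1/2 * a + D"
      using a D by (subst (asm) ennreal_le_iff) auto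
    then show ?thesis unfolding a(1) by (intro ennreal_leI) simp
  qed
  have "(\<integral>\<^sup>+u. ennreal (g u ^ p) \<partial>\<sigma>)
        \<le> (\<integral>\<^sup>+u. liminf (\<lambda>k. ennreal (min (g u) (real k) ^ p)) \<partial>\<sigma>)"
  proof (intro nn_integral_mono Liminf_bounded)
    fix u
    obtain k0 :: nat where k0: "g u \<le> real k0" using real_arch_simple by blast
    show "\<forall>\<^sub>F k in sequentially. ennreal (g u ^ p) \<le> ennreal (min (g u) (real k) ^ p)"
      using eventually_ge_at_top[of k0]
    proof eventually_elim
      case (elim k)
      then have "min (g u) (real k) = g u" using k0 by simp
      then show ?case by simp
    qed
  qed
  also have "\<dots> \<le> liminf (\<lambda>k. \<integral>\<^sup>+u. ennreal (min (g u) (real k) ^ p) \<partial>\<sigma>)"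
    by (rule nn_integral_liminf) measurable
  also have "\<dots> \<le> ennreal (2 * D)"
    by (rule Liminf_le) (simp_all add: trunc)
  finally show ?thesis .
qed

lemma space_sphere_measure [simp]: "space sphere_measure = sphere 0 1"
  and sets_sphere_measure [simp]: "sets sphere_measure = sets sphere_borel"
  by (simp_all add: sphere_measure_def space_scale_measure space_restrict_space)

lemma space_radial_pushforward [simp]: "space (radial_pushforward x M) = sphere 0 1"
  and sets_radial_pushforward [simp]: "sets (radial_pushforward x M) = sets sphere_borel"
  by (simp_all add: radial_pushforward_def space_restrict_space)

lemma finite_measure_sphere_measure: "finite_measure (sphere_measure :: 'a::euclidean_space measure)"
proof
  let ?one = "\<lambda>_::'a. 1 :: ennreal"
  have "emeasure sphere_measure (space (sphere_measure :: 'a measure)) = nn_integral sphere_measure ?one"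
    by simp
  also have "\<dots> = of_nat DIM('a) * emeasure lborel (ball (0::'a) 1)"
    by (subst nn_integral_sphere_measure) simp_all
  also have "\<dots> < \<infinity>"
    using emeasure_lborel_ball_finite[of "0::'a" 1] by (simp add: ennreal_mult_less_top of_nat_less_top)
  finally show "emeasure sphere_measure (space (sphere_measure :: 'a measure)) \<noteq> \<infinity>" by simp
qed

text \<open>
  The measure \<open>N\<close> is \<open>M\<close> translated by \<open>- x\<close>, which changes the transform by a phase. As \<open>x\<close> is not in
  the support, \<open>N\<close> has no mass at the origin, and compactness of the support confines \<open>N\<close> to a ball.
\<close>

lemma radial_pushforward_dominated:
  fixes M :: "(real^'n) measure"
  assumes M: "prob_space M" "sets M = sets borel" and supp: "compact (measure_support M)"
    and x: "x \<notin> measure_support M" and p: "p \<ge> 1"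
    and I: "(\<integral>\<^sup>+\<xi>. ennreal (cmod (fourier_transform M \<xi>)
          * max 1 (norm \<xi>) powr (- (1 / real p))) \<partial>lborel) < \<infinity>"
  obtains N :: "(real^'n) measure" and K :: real where "K \<ge> 0" "finite_measure N" "sets N = sets borel"
    "\<And>\<xi>. cmod (fourier_transform N \<xi>) = cmod (fourier_transform M \<xi>)"
    "\<And>h. h \<in> borel_measurable borel \<Longrightarrow> nn_integral (radial_pushforward x M) h \<le>
      ennreal K * (\<integral>\<^sup>+z. indicator (ball 0 1) z * (h (radial_proj 0 z) * slab_integral N z) \<partial>lborel)"
proof -
  interpret prob_space M by fact
  note [measurable_cong] = M(2)
  define N where "N = distr M borel (\<lambda>w. w - x)"
  have sets: "sets N = sets borel" by (simp add: N_def)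
  have m: "(\<lambda>w. w - x) \<in> M \<rightarrow>\<^sub>M borel" by measurable
  have N: "finite_measure N"
    unfolding N_def using prob_space_distr[OF m] by (rule prob_space.finite_measure)
  have ft: "cmod (fourier_transform N \<xi>) = cmod (fourier_transform M \<xi>)" for \<xi>
    unfolding N_def by (rule cmod_fourier_transform_translate[OF M(2)])
  have sp: "space M = UNIV" using sets_eq_imp_space_eq[OF M(2)] by simp
  have null: "emeasure M A = 0" if "A \<subseteq> - measure_support M" "A \<in> sets borel" for A
    using that measure_support_complement_null[OF M(2)] null_sets_subset[of _ M A] M(2) by auto
  obtain C where C: "C > 0" "\<And>w. w \<in> measure_support M \<Longrightarrow> norm (w - x) < C"
  proof -
    have "bounded ((\<lambda>w. w - x) ` measure_support M)"
      by (intro compact_imp_bounded compact_continuous_image supp continuous_intros)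
    then obtain b where "b > 0" "\<And>w. w \<in> measure_support M \<Longrightarrow> norm (w - x) \<le> b"
      by (auto simp: bounded_pos)
    then show thesis by (intro that[of "b + 1"]) force+
  qed
  have null0: "emeasure N {0} = 0"
  proof -
    have "emeasure N {0} = emeasure M {x}"
      unfolding N_def by (subst emeasure_distr[OF m]) (auto simp: sp vimage_def)
    then show ?thesis using null[of "{x}"] x by simp
  qed
  have nullC: "emeasure N (- ball 0 C) = 0"
  proof -
    have "emeasure N (- ball 0 C) = emeasure M ((\<lambda>w. w - x) -` (- ball 0 C) \<inter> space M)"
      unfolding N_def by (rule emeasure_distr[OF m]) simp
    also have "\<dots> = 0"
      using measurable_sets[OF m, of "- ball 0 C"] C(2) M(2) by (intro null) fastforce+
    finally show ?thesis .
  qed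
  have fin: "(\<integral>\<^sup>+z. indicator (ball 0 1) z * slab_integral N z \<partial>lborel) < \<infinity>"
  proof -
    have "(\<integral>\<^sup>+z. indicator (ball 0 1) z * slab_integral N z \<partial>lborel) \<le>
      (\<integral>\<^sup>+\<xi>. ennreal (cmod (fourier_transform N \<xi>) * max 1 (norm \<xi>) powr (- (1 / real p))) \<partial>lborel) *
      (ennreal 1 * (\<integral>\<^sup>+z. indicator (ball 0 1) (z::real^'n) * ennreal (1 ^ p) \<partial>lborel) +
       ennreal (exp (1/2) * sqrt (2 * pi) ^ CARD('n) / 1 ^ (p - 1)))"
      using ball_integral_slab_integral_le[OF N sets _ _ p, of "\<lambda>_. 1" 1] by simp
    also have "\<dots> < \<infinity>"
      using I emeasure_lborel_ball_finite[of "0::real^'n" 1] by (simp add: ft ennreal_mult_less_top)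
    finally show ?thesis .
  qed
  show thesis
  proof (rule that[OF _ N sets ft])
    show "sqrt (2 * pi) * (C + 1) ^ CARD('n) * exp ((C + 1)\<^sup>2 / 2) \<ge> 0"
      using C(1) by simp
    fix h :: "real^'n \<Rightarrow> ennreal" assume h: "h \<in> borel_measurable borel"
    show "nn_integral (radial_pushforward x M) h \<le>
      ennreal (sqrt (2 * pi) * (C + 1) ^ CARD('n) * exp ((C + 1)\<^sup>2 / 2)) *
      (\<integral>\<^sup>+z. indicator (ball 0 1) z * (h (radial_proj 0 z) * slab_integral N z) \<partial>lborel)"
      using nn_integral_radial_pushforward_le[OF M(2) h, of x]
        nn_integral_radial_proj_le[OF N sets C(1) null0 nullC fin h]
      unfolding N_def[symmetric] by (rule order_trans)
  qed
qed

text \<open>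
  The cone over a null set of directions is Lebesgue null, so the dominating measure gives it no mass.
\<close>

lemma radial_pushforward_absolutely_continuous:
  fixes M :: "(real^'n) measure"
  assumes M: "prob_space M" "sets M = sets borel" and supp: "compact (measure_support M)"
    and x: "x \<notin> measure_support M" and p: "p \<ge> 1"
    and I: "(\<integral>\<^sup>+\<xi>. ennreal (cmod (fourier_transform M \<xi>)
          * max 1 (norm \<xi>) powr (- (1 / real p))) \<partial>lborel) < \<infinity>"
  shows "absolutely_continuous sphere_measure (radial_pushforward x M)"
proof -
  obtain N :: "(real^'n) measure" and K where K: "K \<ge> 0" and N: "finite_measure N" "sets N = sets borel"
    and le: "\<And>h. h \<in> borel_measurable borel \<Longrightarrow> nn_integral (radial_pushforward x M) h \<le>
      ennreal K * (\<integral>\<^sup>+z. indicator (ball 0 1) z * (h (radial_proj 0 z) * slab_integral N z) \<partial>lborel)"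
    by (rule radial_pushforward_dominated[OF assms]) blast
  show ?thesis
    unfolding absolutely_continuous_def
  proof
    fix A :: "(real^'n) set" assume A: "A \<in> null_sets sphere_measure"
    then have A_sphere: "A \<in> sets sphere_borel" by (auto simp: null_sets_def)
    then have [measurable]: "A \<in> sets borel"
      by (auto simp: sets_restrict_space)
    have [measurable]: "ball (0::real^'n) 1 \<in> sets borel" by simp
    have "nn_integral sphere_measure (indicator A) = 0"
      using A by (auto simp: null_sets_def)
    then have "(\<integral>\<^sup>+z. indicator (ball 0 1) z * indicator A (radial_proj 0 z)
          \<partial>(lborel :: (real^'n) measure)) = 0"
      by (subst (asm) nn_integral_sphere_measure) auto
    then have "AE z in (lborel :: (real^'n) measure). indicator (ball 0 1) z * indicator A (radial_proj 0 z) = (0::ennreal)"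
      by (subst (asm) nn_integral_0_iff_AE) auto
    then have "(\<integral>\<^sup>+z. indicator (ball 0 1) z * (indicator A (radial_proj 0 z) * slab_integral N z)
          \<partial>lborel) = (\<integral>\<^sup>+z. 0 \<partial>(lborel :: (real^'n) measure))"
      by (intro nn_integral_cong_AE, eventually_elim) (simp add: mult.assoc[symmetric])
    then have "nn_integral (radial_pushforward x M) (indicator A) = 0"
      using le[of "indicator A"] by simp
    then show "A \<in> null_sets (radial_pushforward x M)"
      using A_sphere by (auto simp: null_sets_def)
  qed
qed

text \<open>
  The density \<open>g\<close> comes from the Radon-Nikodym theorem. Testing the domination against
  \<open>min g k ^ (p - 1)\<close> bounds the \<open>p\<close>-th moment of the truncation by a small multiple of itself plus a constant.
\<close>

lemma radial_pushforward_density_Lp: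
  fixes M :: "(real^'n) measure"
  assumes M: "prob_space M" "sets M = sets borel" and supp: "compact (measure_support M)"
    and x: "x \<notin> measure_support M" and p: "p \<ge> 1"
    and I: "(\<integral>\<^sup>+\<xi>. ennreal (cmod (fourier_transform M \<xi>)
          * max 1 (norm \<xi>) powr (- (1 / real p))) \<partial>lborel) < \<infinity>"
  obtains g :: "real^'n \<Rightarrow> real" where "g \<in> borel_measurable sphere_measure" "\<And>u. g u \<ge> 0"
    "radial_pushforward x M = density sphere_measure (\<lambda>u. ennreal (g u))"
    "integrable sphere_measure (\<lambda>u. g u ^ p)"
proof -
  obtain N :: "(real^'n) measure" and K where K: "K \<ge> 0" and N: "finite_measure N" "sets N = sets borel"
    and ft: "\<And>\<xi>. cmod (fourier_transform N \<xi>) = cmod (fourier_transform M \<xi>)"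
    and le: "\<And>h. h \<in> borel_measurable borel \<Longrightarrow> nn_integral (radial_pushforward x M) h \<le>
      ennreal K * (\<integral>\<^sup>+z. indicator (ball 0 1) z * (h (radial_proj 0 z) * slab_integral N z) \<partial>lborel)"
    by (rule radial_pushforward_dominated[OF assms]) blast
  let ?\<sigma> = "sphere_measure :: (real^'n) measure"
  let ?\<nu> = "radial_pushforward x M"
  interpret \<sigma>: finite_measure ?\<sigma> by (rule finite_measure_sphere_measure)
  interpret \<nu>: prob_space ?\<nu> by (rule prob_space_radial_pushforward[OF M x])
  have ac: "absolutely_continuous ?\<sigma> ?\<nu>"
    by (rule radial_pushforward_absolutely_continuous[OF assms])
  have sets_eq: "sets ?\<nu> = sets ?\<sigma>" by simp
  obtain f where f [measurable]: "f \<in> borel_measurable ?\<sigma>" and fd: "density ?\<sigma> f = ?\<nu>"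
    using \<sigma>.Radon_Nikodym[OF ac sets_eq] by blast
  have "(\<integral>\<^sup>+u. f u \<partial>?\<sigma>) = emeasure (density ?\<sigma> f) (space ?\<sigma>)"
    using sets.top[of ?\<sigma>] by (subst emeasure_density) (auto intro!: nn_integral_cong)
  also have "\<dots> = 1" unfolding fd using \<nu>.emeasure_space_1 by simp
  finally have "AE u in ?\<sigma>. f u \<noteq> \<infinity>"
    by (intro nn_integral_PInf_AE f) simp
  (* Extension by zero makes g Borel on the whole space, as needed to test the domination against it. *)
  define g where "g u = enn2real (f u) * indicator (sphere 0 1) u" for u
  have fb: "f \<in> borel_measurable (restrict_space borel (sphere 0 1))"
    using f by (simp cong: measurable_cong_sets)
  have gb [measurable]: "g \<in> borel_measurable borel"
  proof -
    have "(\<lambda>u. enn2real (f u)) \<in> borel_measurable (restrict_space borel (sphere 0 1))"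
      using fb by measurable
    then show ?thesis
      unfolding g_def by (subst (asm) borel_measurable_restrict_space_iff) (auto simp: mult.commute)
  qed
  have g\<sigma> [measurable]: "g \<in> borel_measurable ?\<sigma>"
    using measurable_restrict_space1[OF gb, of "sphere 0 1"] by (simp cong: measurable_cong_sets)
  have g0: "g u \<ge> 0" for u by (simp add: g_def)
  have gd: "?\<nu> = density ?\<sigma> (\<lambda>u. ennreal (g u))"
    unfolding fd[symmetric]
  proof (rule density_cong)
    show "AE u in ?\<sigma>. f u = ennreal (g u)"
      using \<open>AE u in ?\<sigma>. f u \<noteq> \<infinity>\<close> AE_space
      by eventually_elim (auto simp: g_def top.not_eq_extremum)
  qed measurable
  let ?I = "\<integral>\<^sup>+\<xi>. ennreal (cmod (fourier_transform N \<xi>)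
        * max 1 (norm \<xi>) powr (- (1 / real p))) \<partial>lborel"
  obtain I' where I': "?I = ennreal I'" "I' \<ge> 0"
    using I unfolding ft by (cases ?I) (auto simp: ft)
  let ?c = "exp (1/2) * sqrt (2 * pi) ^ CARD('n)"
  (* With this choice the coefficient K * I' * \<eta> of the moment is at most 1/2. *)
  define \<eta> where "\<eta> = 1 / (2 * (K * I' + 1))"
  have KI: "K * I' \<ge> 0" using K I' by simp
  then have \<eta>: "\<eta> > 0" by (simp add: \<eta>_def)
  have half: "K * I' * \<eta> \<le> 1/2" using KI by (simp add: \<eta>_def divide_simps)
  define D where "D = K * I' * (?c / \<eta> ^ (p - 1))"
  have D: "D \<ge> 0" using KI \<eta> by (simp add: D_def)
  have "(\<integral>\<^sup>+u. ennreal (g u ^ p) \<partial>?\<sigma>) \<le> ennreal (2 * D)"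
  proof (rule nn_integral_power_le_if_absorbing[OF _ g\<sigma> g0 p _ D])
    show "emeasure ?\<sigma> (space ?\<sigma>) < \<infinity>"
      using \<sigma>.emeasure_finite[of "space ?\<sigma>"] by (simp only: infinity_ennreal_def less_top)
    fix k :: nat
    let ?u = "\<lambda>u. min (g u) (real k)"
    let ?A = "\<integral>\<^sup>+u. ennreal (?u u ^ p) \<partial>?\<sigma>"
    let ?U = "\<integral>\<^sup>+z. indicator (ball 0 1) z * ennreal (?u (radial_proj 0 z) ^ p) \<partial>lborel"
    have U: "?U \<le> ?A"
    proof -
      have "of_nat DIM(real^'n) * ?U = ?A"
        by (rule nn_integral_sphere_measure[symmetric]) measurable
      moreover have "1 * ?U \<le> of_nat DIM(real^'n) * ?U"
        by (intro mult_right_mono) (simp_all add: Suc_leI)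
      ultimately show ?thesis by simp
    qed
    have "(\<integral>\<^sup>+u. ennreal (g u) * ennreal (?u u ^ (p - 1)) \<partial>?\<sigma>)
          = (\<integral>\<^sup>+u. ennreal (?u u ^ (p - 1)) \<partial>?\<nu>)"
      unfolding gd by (rule nn_integral_density[symmetric]) measurable
    also have "\<dots> \<le> ennreal K * (\<integral>\<^sup>+z. indicator (ball 0 1) z
          * (ennreal (?u (radial_proj 0 z) ^ (p - 1)) * slab_integral N z) \<partial>lborel)"
      by (rule le) measurable
    also have "\<dots> \<le> ennreal K * (?I * (ennreal \<eta> * ?U + ennreal (?c / \<eta> ^ (p - 1))))"
      using g0 by (intro mult_left_mono ball_integral_slab_integral_le[OF N _ _ p \<eta>]) auto
    also have "\<dots> \<le> ennreal K * (?I * (ennreal \<eta> * ?A + ennreal (?c / \<eta> ^ (p - 1))))"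
      by (intro mult_left_mono add_right_mono U) simp_all
    also have "\<dots> = ennreal (K * I' * \<eta>) * ?A + ennreal D"
    proof -
      have q: "?c / \<eta> ^ (p - 1) \<ge> 0" using \<eta> by simp
      have D_eq: "ennreal D = ennreal K * (ennreal I' * ennreal (?c / \<eta> ^ (p - 1)))"
        unfolding D_def using K I'(2) q by (simp only: ennreal_mult mult_nonneg_nonneg mult.assoc)
      have "ennreal (K * I' * \<eta>) = ennreal K * (ennreal I' * ennreal \<eta>)"
        using K I'(2) \<eta> by (simp add: ennreal_mult mult.assoc)
      then show ?thesis unfolding I'(1) D_eq by (simp only: distrib_left mult.assoc)
    qed
    also have "\<dots> \<le> ennreal (1/2) * ?A + ennreal D"
      using half by (intro add_right_mono mult_right_mono ennreal_leI) simp_all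
    finally show "(\<integral>\<^sup>+u. ennreal (g u) * ennreal (?u u ^ (p - 1)) \<partial>?\<sigma>)
          \<le> ennreal (1/2) * ?A + ennreal D" .
  qed
  also have "\<dots> < \<infinity>" by simp
  finally have "integrable ?\<sigma> (\<lambda>u. g u ^ p)"
    using g0 by (intro integrableI_nonneg) auto
  then show thesis using that g\<sigma> g0 gd by blast
qed

theorem theorem2p1:
  fixes M :: "(real^'n) measure"
  assumes "CARD('n) \<ge> 2"
    and "prob_space M" and "sets M = sets borel" and "compact (measure_support M)"
  shows
    "(l1_dim M > ennreal (real CARD('n) - 1) \<longrightarrow>
        (\<forall>x. x \<notin> measure_support M \<longrightarrow>
           lower_hausdorff_dim (radial_pushforward x M) = ennreal (real CARD('n) - 1) \<longrightarrow>
           absolutely_continuous sphere_measure (radial_pushforward x M)))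
     \<and>
     (\<forall>p::nat. p > 1 \<longrightarrow> l1_dim M > ennreal (real CARD('n) - 1 / real p) \<longrightarrow>
        (\<forall>x. x \<notin> measure_support M \<longrightarrow>
           absolutely_continuous sphere_measure (radial_pushforward x M) \<and>
           (\<exists>f :: real^'n \<Rightarrow> real.
              f \<in> borel_measurable sphere_measure \<and> (\<forall>u. f u \<ge> 0) \<and>
              radial_pushforward x M = density sphere_measure (\<lambda>u. ennreal (f u)) \<and>
              integrable sphere_measure (\<lambda>u. f u ^ p))))"
proof (intro conjI impI allI)
  fix x assume "l1_dim M > ennreal (real CARD('n) - 1)" and x: "x \<notin> measure_support M"
  then have "(\<integral>\<^sup>+\<xi>. ennreal (cmod (fourier_transform M \<xi>) * max 1 (norm \<xi>) powr (- (1 / real 1))) \<partial>lborel) < \<infinity>"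
    using fourier_weighted_integral_finite[OF assms(2,3), of 1] by simp
  then show "absolutely_continuous sphere_measure (radial_pushforward x M)"
    using radial_pushforward_absolutely_continuous[OF assms(2-4) x, of 1] by simp
next
  fix p :: nat and x
  assume p: "p > 1" and dim: "l1_dim M > ennreal (real CARD('n) - 1 / real p)" and x: "x \<notin> measure_support M"
  have I: "(\<integral>\<^sup>+\<xi>. ennreal (cmod (fourier_transform M \<xi>) * max 1 (norm \<xi>) powr (- (1 / real p))) \<partial>lborel) < \<infinity>"
    using p by (intro fourier_weighted_integral_finite[OF assms(2,3) _ dim]) simp
  have p1: "p \<ge> 1" using p by simp
  show "absolutely_continuous sphere_measure (radial_pushforward x M)"
    by (rule radial_pushforward_absolutely_continuous[OF assms(2-4) x p1 I])
  show "\<exists>f :: real^'n \<Rightarrow> real. f \<in> borel_measurable sphere_measure \<and> (\<forall>u. f u \<ge> 0) \<and>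
     radial_pushforward x M = density sphere_measure (\<lambda>u. ennreal (f u)) \<and>
     integrable sphere_measure (\<lambda>u. f u ^ p)"
    by (rule radial_pushforward_density_Lp[OF assms(2-4) x p1 I]) blast
qed

end
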